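(* There exists $N_0\ge 16$ such that for every integer $N\ge N_0$ and every $\rho\in[2/3,1)$ the following hold for the kernel $K_\flat$, the operator $H_\flat$ and the measures $\widehat\omega,\widehat\sigma$ defined in the context: (i) $K_\flat$ is odd, smooth on $\mathbb R\setminus\{0\}$, the convolution kernel $K(x,y)=K_\flat(x-y)$ is a standard Calderón–Zygmund kernel, and $K_\flat$ is elliptic: there are constants $0<c\le C<\infty$ (depending on $N$) with $c/|x|\le |K_\flat(x)|\le C/|x|$ for all $x\ne0$; (ii) $H_\flat$ is bounded from $L^2(\widehat\sigma)$ to $L^2(\widehat\omega)$, in the (dual) form: there is $C<\infty$ with $$\int \big|H_\flat(g\widehat\omega)\big|^2\,d\widehat\sigma\le C\int|g|^2\,d\widehat\omega\qquad\text{for all }g\in L^2(\widehat\omega),$$ where $H_\flat(g\widehat\omega)(y)=\int K_\flat(y-x)g(x)\,d\widehat\omega(x)$ is absolutely convergent for every $y$ in the support of $\widehat\sigma$; (iii) the pair $(\widehat\sigma,\widehat\omega)$ fails the backward energy condition: $$\sup\ \frac{1}{|I_0|_{\widehat\omega}}\sum_{r\ge1}|I_r|_{\widehat\sigma}\,\mathsf E(I_r,\widehat\sigma)^2\,\mathrm P(I_r,\mathbf 1_{I_0}\widehat\omega)^2=\infty,$$ the supremum being over all intervals $I_0$ with $|I_0|_{\widehat\omega}>0$ and all decompositions $I_0=\bigcup_{r\ge1}I_r$ into pairwise disjoint intervals (terms with $|I_r|_{\widehat\sigma}=0$ are taken to be $0$).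
   Context: Notation: for a positive Borel measure $\mu$ and interval $I$, $|I|_\mu=\mu(I)$, $|I|$ is Lebesgue length. Poisson integral: $\mathrm P(I,\mu)=\int_{\mathbb R}\frac{|I|}{(|I|+\operatorname{dist}(x,I))^2}\,d\mu(x)$. Energy: for $|I|_\mu>0$, $\mathsf E(I,\mu)^2=\frac12\,\frac{1}{|I|_\mu^2}\int_I\int_I\frac{(x-x')^2}{|I|^2}\,d\mu(x)\,d\mu(x')$. A standard Calderón–Zygmund kernel on $\mathbb R$ is a real function $K(x,y)$ on $x\neq y$ with $|K(x,y)|\le C|x-y|^{-1}$, $|\nabla K(x,y)|\le C|x-y|^{-2}$, and $|\nabla K(x,y)-\nabla K(x',y)|\le C(|x-x'|/|x-y|)^\delta|x-y|^{-2}$ whenever $|x-x'|\le\frac12|x-y|$, for some $\delta>0$, and the same with the roles of $x,y$ interchanged. Cantor intervals: fix an integer $N\ge16$ and $\rho\in[2/3,1)$. Set $I^0_1=[0,1]$. Each interval $I=[a,a+N^{-k}]$ of generation $k$ has two children of generation $k+1$: the left child $I_-=[a,a+N^{-k-1}]$ and the right child $I_+=[a+N^{-k}-N^{-k-1},a+N^{-k}]$. The $2^k$ intervals of generation $k$ are denoted $I^k_j$, $1\le j\le 2^k$, numbered left to right; $\mathcal D$ is the collection of all of them. $G^k_j$ is the open middle gap $I^k_j\setminus((I^k_j)_-\cup(I^k_j)_+)$, $\dot z^k_j$ is the common center of $I^k_j$ and $G^k_j$, and $L^k_j=[\dot z^k_j-N^{-k-1},\dot z^k_j+N^{-k-1}]$.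 The Cantor set is $\mathsf E^{(N)}=\bigcap_{k}\bigcup_{j}I^k_j$. Redistributed Cantor measure: with $\eta=1/N$, $\widehat\omega$ is the unique Borel probability measure supported on $\mathsf E^{(N)}$ such that $\widehat\omega(I^1_1)=\widehat\omega(I^1_2)=\frac12$ and for every $I\in\mathcal D$ of generation $\ge1$: if $I$ is the left child of its parent then $\widehat\omega(I_-)=\frac{1+\eta}2\widehat\omega(I)$, $\widehat\omega(I_+)=\frac{1-\eta}2\widehat\omega(I)$; if $I$ is the right child of its parent then $\widehat\omega(I_-)=\frac{1-\eta}2\widehat\omega(I)$, $\widehat\omega(I_+)=\frac{1+\eta}2\widehat\omega(I)$. Weights: $\widehat s^k_j=N^{-2k}/\widehat\omega(I^k_j)$ (so $\widehat\omega(I^k_j)\,\widehat s^k_j=|I^k_j|^2$); $\widehat{\dot\sigma}=\sum_{k\ge0}\sum_{j=1}^{2^k}\widehat s^k_j\,\delta_{\dot z^k_j}$ and $\widehat\sigma=\sum_{k\ge0}\sum_{j=1}^{2^k}\widehat s^k_j\,|L^k_j|^{-1}\mathbf 1_{L^k_j}(x)\,dx$. Flattened kernel: $K_\flat$ is defined first on $[N^{-1/2},N^{1/2}]$ as a smooth nonincreasing function with values in $[N^{-1/2},N^{1/2}]$ such that $K_\flat(x)=1/x$ for $N^{-1/2}\le x\le(\rho N)^{-1/2}$ and for $(\rho N)^{1/2}\le x\le N^{1/2}$, and $K_\flat(x)=1$ for $(\rho^2N)^{-1/2}\le x\le(\rho^2N)^{1/2}$; then extended to $(0,\infty)$ by $K_\flat(x)=N^{-k}K_\flat(N^{-k}x)$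 for $x\in[N^{k-1/2},N^{k+1/2}]$, $k\in\mathbb Z$, and to $\mathbb R\setminus\{0\}$ as an odd function. $H_\flat\mu(x)=\int K_\flat(x-y)\,d\mu(y)$ (with the usual truncations when needed).
   Formalization: In (ii), absolute convergence is asserted for every y in the union of the intervals L^k_j, not in the closed support of σ̂, which also contains the Cantor set, where the integral diverges (e.g. for g = 1). *)

theory Defs
  imports "HOL-Analysis.Analysis"
begin

section \<open>Cantor intervals (generation k, index j in {0..<2^k}, numbered left to right)\<close>

fun cleft :: "nat \<Rightarrow> nat \<Rightarrow> nat \<Rightarrow> real" where
  "cleft N 0 j = 0"
| "cleft N (Suc k) j = cleft N k (j div 2) +
     (if odd j then (1 / real N) ^ k - (1 / real N) ^ Suc k else 0)"

definition cint :: "nat \<Rightarrow> nat \<Rightarrow> nat \<Rightarrow> real set" where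
  "cint N k j = {cleft N k j .. cleft N k j + (1 / real N) ^ k}"

definition ccenter :: "nat \<Rightarrow> nat \<Rightarrow> nat \<Rightarrow> real" where
  "ccenter N k j = cleft N k j + (1 / real N) ^ k / 2"

definition Lint :: "nat \<Rightarrow> nat \<Rightarrow> nat \<Rightarrow> real set" where
  "Lint N k j = {ccenter N k j - (1 / real N) ^ Suc k .. ccenter N k j + (1 / real N) ^ Suc k}"

definition cantor_set :: "nat \<Rightarrow> real set" where
  "cantor_set N = (\<Inter>k. \<Union>j\<in>{..<2^k}. cint N k j)"

text \<open>omega_w N k j is the prescribed mass of the interval cint N k j.\<close>
fun omega_w :: "nat \<Rightarrow> nat \<Rightarrow> nat \<Rightarrow> real" where
  "omega_w N 0 j = 1"
| "omega_w N (Suc k) j = omega_w N k (j div 2) *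
     (if k = 0 then 1 / 2
      else if even j = even (j div 2) then (1 + 1 / real N) / 2
      else (1 - 1 / real N) / 2)"

text \<open>A Borel probability measure supported on the Cantor set with the prescribed masses
  (by the paper such a measure exists and is unique).\<close>
definition redistributed_cantor :: "nat \<Rightarrow> real measure \<Rightarrow> bool" where
  "redistributed_cantor N \<omega> \<longleftrightarrow>
     sets \<omega> = sets borel \<and> emeasure \<omega> (space \<omega>) = 1 \<and>
     emeasure \<omega> (- cantor_set N) = 0 \<and>
     (\<forall>k j. j < 2 ^ k \<longrightarrow> emeasure \<omega> (cint N k j) = ennreal (omega_w N k j))"

definition s_hat :: "nat \<Rightarrow> nat \<Rightarrow> nat \<Rightarrow> real" where
  "s_hat N k j = (1 / real N) ^ (2 * k) / omega_w N k j"

definition sigma_hat :: "nat \<Rightarrow> real measure" where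
  "sigma_hat N = density lborel (\<lambda>x. \<Sum>k. \<Sum>j<2^k.
      ennreal (s_hat N k j / (2 * (1 / real N) ^ Suc k)) * indicator (Lint N k j) x)"

definition C_infty_on :: "real set \<Rightarrow> (real \<Rightarrow> real) \<Rightarrow> bool" where
  "C_infty_on S f \<longleftrightarrow> (\<exists>D :: nat \<Rightarrow> real \<Rightarrow> real. (\<forall>x\<in>S. D 0 x = f x) \<and>
      (\<forall>n. \<forall>x\<in>S. (D n has_real_derivative D (Suc n) x) (at x)))"

definition admissible_base :: "nat \<Rightarrow> real \<Rightarrow> (real \<Rightarrow> real) \<Rightarrow> bool" where
  "admissible_base N \<rho> b \<longleftrightarrow>
     (let a = real N powr (-1/2); B = real N powr (1/2) in
       C_infty_on {a<..<B} b \<and>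
       (\<forall>x\<in>{a..B}. \<forall>y\<in>{a..B}. x \<le> y \<longrightarrow> b y \<le> b x) \<and>
       (\<forall>x\<in>{a..B}. a \<le> b x \<and> b x \<le> B) \<and>
       (\<forall>x. (a \<le> x \<and> x \<le> (\<rho> * N) powr (-1/2)) \<or> ((\<rho> * N) powr (1/2) \<le> x \<and> x \<le> B)
              \<longrightarrow> b x = 1 / x) \<and>
       (\<forall>x. (\<rho>^2 * N) powr (-1/2) \<le> x \<and> x \<le> (\<rho>^2 * N) powr (1/2) \<longrightarrow> b x = 1))"

text \<open>Extension K(x) = N^(-k) b(N^(-k) x) for x in [N^(k-1/2), N^(k+1/2)], odd; value 0 at 0.\<close>
definition kflat_pos :: "nat \<Rightarrow> (real \<Rightarrow> real) \<Rightarrow> real \<Rightarrow> real" where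
  "kflat_pos N b x = (let k = \<lfloor>log (real N) x + 1/2\<rfloor> in
      real N powr (- real_of_int k) * b (real N powr (- real_of_int k) * x))"

definition kflat :: "nat \<Rightarrow> (real \<Rightarrow> real) \<Rightarrow> real \<Rightarrow> real" where
  "kflat N b x = (if x > 0 then kflat_pos N b x else if x < 0 then - kflat_pos N b (- x) else 0)"

definition std_CZ_kernel :: "(real \<Rightarrow> real \<Rightarrow> real) \<Rightarrow> bool" where
  "std_CZ_kernel K \<longleftrightarrow> (\<exists>(C::real) (\<delta>::real) (G :: real \<Rightarrow> real \<Rightarrow> real \<times> real). \<delta> > 0 \<and>
     (\<forall>x y. x \<noteq> y \<longrightarrow>
        \<bar>K x y\<bar> \<le> C / \<bar>x - y\<bar> \<and>
        ((\<lambda>p. K (fst p) (snd p)) has_derivative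
           (\<lambda>h. fst (G x y) * fst h + snd (G x y) * snd h)) (at (x, y)) \<and>
        norm (G x y) \<le> C / \<bar>x - y\<bar>^2) \<and>
     (\<forall>x x' y. x \<noteq> y \<and> \<bar>x - x'\<bar> \<le> \<bar>x - y\<bar> / 2 \<longrightarrow>
        norm (G x y - G x' y) \<le> C * (\<bar>x - x'\<bar> / \<bar>x - y\<bar>) powr \<delta> / \<bar>x - y\<bar>^2) \<and>
     (\<forall>x y y'. x \<noteq> y \<and> \<bar>y - y'\<bar> \<le> \<bar>x - y\<bar> / 2 \<longrightarrow>
        norm (G x y - G x y') \<le> C * (\<bar>y - y'\<bar> / \<bar>x - y\<bar>) powr \<delta> / \<bar>x - y\<bar>^2))"

definition poisson :: "real set \<Rightarrow> real measure \<Rightarrow> ennreal" where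
  "poisson I \<mu> = (\<integral>\<^sup>+ x. ennreal (measure lborel I / (measure lborel I + infdist x I)^2) \<partial>\<mu>)"

definition energy_sq :: "real set \<Rightarrow> real measure \<Rightarrow> ennreal" where
  "energy_sq I \<mu> =
     (\<integral>\<^sup>+ x \<in> I. (\<integral>\<^sup>+ x' \<in> I. ennreal ((x - x')^2 / (measure lborel I)^2) \<partial>\<mu>) \<partial>\<mu>)
       / (2 * (emeasure \<mu> I)^2)"

definition backward_term :: "real measure \<Rightarrow> real measure \<Rightarrow> real set \<Rightarrow> real set \<Rightarrow> ennreal" where
  "backward_term \<sigma> \<omega> I0 I =
     (if emeasure \<sigma> I = 0 then 0
      else emeasure \<sigma> I * energy_sq I \<sigma> * (poisson I (density \<omega> (indicator I0)))^2)"

definition interval_decomps :: "real measure \<Rightarrow> (real set \<times> (nat \<Rightarrow> real set)) set" where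
  "interval_decomps \<omega> = {(I0, I). is_interval I0 \<and> bounded I0 \<and> emeasure \<omega> I0 > 0 \<and>
       (\<forall>r. is_interval (I r)) \<and> disjoint_family I \<and> (\<Union>r. I r) = I0}"

end

theory Submission
  imports Defs
begin

text \<open>
  Smoothness and the size estimates for \<open>K = kflat N b\<close> reduce to one period by the homogeneity
  \<open>K (N^k x) = N^(-k) K x\<close>: at a junction of two periods \<open>K\<close> coincides with \<open>1/x\<close>, and on
  the compact fundamental interval all derivatives are bounded.

  For \<open>y\<close> in \<open>Lint N k j\<close> and \<open>x\<close> in the Cantor set, \<open>y - x\<close> lies in a flat zone of \<open>K\<close>.
  Hence \<open>H (g \<omega>)\<close> is constant on each \<open>Lint N k j\<close>, with a value \<open>T I\<close> that depends only on
  the masses \<open>A I\<close> of \<open>g \<omega>\<close> on the Cantor intervals. Passing from an interval \<open>I\<close> of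
  generation \<open>k\<close> to a child \<open>J\<close> changes \<open>T\<close> by \<open>N^(k+1) d J\<close>, where \<open>d J\<close> vanishes if \<open>g\<close>
  is constant (this is what the redistribution achieves) and is a martingale difference of \<open>g\<close>
  in general. So \<open>q = N^(-k) T\<close> obeys \<open>q J = q I / N + d J\<close>, and the sums over generations of
  \<open>q^2 / \<omega>\<close> are controlled by a contraction plus the increments of the sums of \<open>A^2 / \<omega>\<close>,
  which telescope and are bounded by \<open>\<integral> g^2 d\<omega>\<close>.

  The backward energy condition fails on \<open>[0,1]\<close>: each \<open>Lint N k j\<close> contributes at least a
  constant times the mass of \<open>cint N k j\<close>, so each generation contributes at least a fixed amount.
\<close>

subsection \<open>The flattened kernel\<close>

text \<open>On an open set derivatives are unique, so any witness \<open>D\<close> of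
  \<open>C_infty_on\<close> agrees there with the iterated \<open>deriv\<close>. This yields a
  canonical witness that does not depend on \<open>D\<close>.\<close>

lemma C_infty_on_higher_deriv:
  assumes "open U" "C_infty_on U f" "x \<in> U"
  shows "((deriv ^^ n) f has_real_derivative (deriv ^^ Suc n) f x) (at x)"
proof -
  obtain D where D0: "\<And>x. x \<in> U \<Longrightarrow> D 0 x = f x"
    and D: "\<And>n x. x \<in> U \<Longrightarrow> (D n has_real_derivative D (Suc n) x) (at x)"
    using assms(2) unfolding C_infty_on_def by blast
  have step: "((deriv ^^ n) f has_real_derivative D (Suc n) x) (at x)"
    if eq: "\<And>x. x \<in> U \<Longrightarrow> (deriv ^^ n) f x = D n x" and "x \<in> U" for n x
    using D[OF \<open>x \<in> U\<close>] assms(1) \<open>x \<in> U\<close>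
    by (rule has_field_derivative_transform_within_open) (simp add: eq)
  have eq: "(deriv ^^ n) f x = D n x" if "x \<in> U" for n x
    using that
  proof (induction n arbitrary: x)
    case 0
    then show ?case by (simp add: D0)
  next
    case (Suc n)
    show ?case using DERIV_imp_deriv[OF step[OF Suc.IH Suc.prems]] by simp
  qed
  show ?thesis
    using step[OF eq assms(3), of n] eq[OF assms(3), of "Suc n"] by simp
qed

text \<open>Local witnesses need not match each other, but each agrees near its point with the
  iterated \<open>deriv\<close>, which therefore serves as one global witness.\<close>

lemma C_infty_on_local:
  assumes "\<And>x. x \<in> S \<Longrightarrow> \<exists>U. open U \<and> x \<in> U \<and> C_infty_on U f"
  shows "C_infty_on S f"
  unfolding C_infty_on_def
proof (intro exI[of _ "\<lambda>n. (deriv ^^ n) f"] conjI ballI allI)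
  fix n x assume "x \<in> S"
  then show "((deriv ^^ n) f has_real_derivative (deriv ^^ Suc n) f x) (at x)"
    using assms C_infty_on_higher_deriv by blast
qed simp

lemma C_infty_on_subset:
  assumes "C_infty_on S f" "T \<subseteq> S"
  shows "C_infty_on T f"
  using assms unfolding C_infty_on_def by blast

lemma C_infty_on_cong:
  assumes "C_infty_on S f" "\<And>x. x \<in> S \<Longrightarrow> g x = f x"
  shows "C_infty_on S g"
  using assms unfolding C_infty_on_def by auto

text \<open>The form \<open>c * f (c * x)\<close> is the symmetry of the kernel: \<open>c\<close> a
  power of \<open>N\<close> gives the dilations, \<open>c = -1\<close> the reflection.\<close>

lemma C_infty_on_rescale:
  assumes "C_infty_on U f"
  shows "C_infty_on ((\<lambda>x. c * x) -` U) (\<lambda>x. c * f (c * x))"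
proof -
  obtain D where D0: "\<And>x. x \<in> U \<Longrightarrow> D 0 x = f x"
    and D: "\<And>n x. x \<in> U \<Longrightarrow> (D n has_real_derivative D (Suc n) x) (at x)"
    using assms unfolding C_infty_on_def by blast
  show ?thesis unfolding C_infty_on_def
  proof (intro exI[of _ "\<lambda>n x. c ^ Suc n * D n (c * x)"] conjI ballI allI)
    fix n x assume "x \<in> (\<lambda>x. c * x) -` U"
    then have "c * x \<in> U" by simp
    have "((\<lambda>x. D n (c * x)) has_real_derivative D (Suc n) (c * x) * c) (at x)"
      by (rule DERIV_chain2[where g="\<lambda>x. c * x", OF D[OF \<open>c * x \<in> U\<close>]]) (auto intro!: derivative_eq_intros)
    from DERIV_cmult[OF this, of "c ^ Suc n"]
    show "((\<lambda>x. c ^ Suc n * D n (c * x)) has_real_derivative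
          c ^ Suc (Suc n) * D (Suc n) (c * x)) (at x)"
      by (simp add: mult_ac)
  qed (simp add: D0)
qed

lemma C_infty_on_inverse: "C_infty_on {0<..} (\<lambda>x. 1 / x)"
  unfolding C_infty_on_def
proof (intro exI[of _ "\<lambda>n x. (-1) ^ n * fact n / x ^ Suc n"] conjI ballI allI)
  fix n :: nat and x :: real assume "x \<in> {0<..}"
  then show "((\<lambda>x. (-1) ^ n * fact n / x ^ Suc n) has_real_derivative
        (-1) ^ Suc n * fact (Suc n) / x ^ Suc (Suc n)) (at x)"
    using DERIV_cmult[OF DERIV_inverse_fun[OF DERIV_pow[of "Suc n" x UNIV]], of "(-1) ^ n * fact n"]
    by (simp add: divide_simps mult_ac)
qed simp

section \<open>Homogeneity of the kernel and smoothness across the periods\<close>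

lemma kflat_minus: "kflat N b (- x) = - kflat N b x"
  by (simp add: kflat_def)

text \<open>Dilation by a power of \<open>N\<close> shifts the logarithm by an integer, hence shifts
  the floor that selects the period in \<open>kflat_pos\<close>. Negative arguments follow by
  oddness.\<close>

lemma kflat_scale:
  assumes "N \<ge> 2"
  shows "kflat N b (real N powr real_of_int k * x) = real N powr (- real_of_int k) * kflat N b x"
proof -
  have N: "real N > 1" using assms by simp
  have pos: "kflat_pos N b (real N powr k * x) = real N powr (- k) * kflat_pos N b x" if "x > 0" for x
  proof -
    have "log N (real N powr k * x) + 1/2 = (log N x + 1/2) + real_of_int k"
      using N that by (simp add: log_mult)
    then have fl: "\<lfloor>log N (real N powr k * x) + 1/2\<rfloor> = \<lfloor>log N x + 1/2\<rfloor> + k"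
      by (metis floor_add_int)
    have e: "real N powr (- (real_of_int m + real_of_int k)) * (real N powr k * x) = real N powr (- real_of_int m) * x" for m
      using N by (simp flip: mult.assoc powr_add)
    have e2: "real N powr (- (real_of_int m + real_of_int k)) = real N powr (- k) * real N powr (- real_of_int m)" for m
      by (simp add: algebra_simps flip: powr_add)
    show ?thesis
      unfolding kflat_pos_def fl Let_def of_int_add e by (simp only: e2 mult.assoc)
  qed
  show ?thesis
    using pos[of x] pos[of "-x"] N by (auto simp: kflat_def zero_less_mult_iff mult_less_0_iff)
qed

text \<open>The interval from \<open>N^(-1/2)\<close> to \<open>N^(1/2)\<close>, half-open on the
  right, is a fundamental domain for dilations by powers of \<open>N\<close>; \<open>t\<close>
  represents \<open>x\<close> in it.\<close>

lemma exists_scale: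
  assumes "N \<ge> 2" "x > 0"
  obtains m :: int and t where "real N powr (-1/2) \<le> t" "t < real N powr (1/2)" "x = real N powr m * t"
proof -
  define m where "m = \<lfloor>log N x + 1/2\<rfloor>"
  define t where "t = real N powr (- real_of_int m) * x"
  have N: "real N > 1" using assms by simp
  have lx: "x = real N powr log N x" using N assms by simp
  have t: "t = real N powr (log N x - m)"
    unfolding t_def by (subst (1) lx) (simp flip: powr_add)
  have "-1/2 \<le> log N x - m" "log N x - m < 1/2" unfolding m_def by linarith+
  then have "real N powr (-1/2) \<le> t" "t < real N powr (1/2)"
    unfolding t using N by (auto intro!: powr_mono powr_less_mono)
  moreover have "x = real N powr m * t"
    using N unfolding t_def by (simp flip: mult.assoc powr_add)
  ultimately show ?thesis by (rule that)
qed

text \<open>The upper bound is strict because at \<open>N^(1/2)\<close> the floor is already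
  \<open>1\<close>, so that point belongs to the next period.\<close>

lemma kflat_base:
  assumes "N \<ge> 2" "real N powr (-1/2) \<le> x" "x < real N powr (1/2)"
  shows "kflat N b x = b x"
proof -
  have N: "real N > 1" using assms by simp
  have x: "x > 0" using assms by (smt (verit) powr_gt_zero N)
  have "-1/2 \<le> log N x" using N x assms by (subst le_log_iff) auto
  moreover have "log N x < 1/2" using N x assms by (subst log_less_iff) auto
  ultimately have "\<lfloor>log N x + 1/2\<rfloor> = 0" by linarith
  then show ?thesis using x N by (simp add: kflat_def kflat_pos_def)
qed

context
  fixes N :: nat and \<rho> :: real and b :: "real \<Rightarrow> real"
  assumes N: "N \<ge> 16" and \<rho>: "2/3 \<le> \<rho>" "\<rho> < 1" and adm: "admissible_base N \<rho> b"
begin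

lemma admissible_bounds:
  assumes "real N powr (-1/2) \<le> x" "x \<le> real N powr (1/2)"
  shows "real N powr (-1/2) \<le> b x" "b x \<le> real N powr (1/2)"
  using adm assms unfolding admissible_base_def Let_def by auto

lemma rhoN_less: "(\<rho> * N) powr (1/2) < real N powr (1/2)" "real N powr (-1/2) < (\<rho> * N) powr (-1/2)"
proof -
  have "\<rho> * N < real N" "0 < \<rho> * N" using N \<rho> by auto
  then show "(\<rho> * N) powr (1/2) < real N powr (1/2)" "real N powr (-1/2) < (\<rho> * N) powr (-1/2)"
    by (auto intro: powr_less_mono2 powr_less_mono2_neg)
qed

text \<open>To the left of \<open>N^(1/2)\<close> this is the final stretch of \<open>b\<close>,
  where it equals \<open>1/x\<close>. To the right it is the rescaled initial stretch, and
  \<open>1/x\<close> is invariant under the rescaling.\<close>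

lemma kflat_near_junction:
  assumes "(\<rho> * N) powr (1/2) < x" "x < N * (\<rho> * N) powr (-1/2)"
  shows "kflat N b x = 1 / x"
proof -
  have Npos: "real N > 0" using N by simp
  have x: "x > 0" using assms by (smt (verit) powr_ge_zero)
  show ?thesis
  proof (cases "x < real N powr (1/2)")
    case True
    \<comment> \<open>Since \<open>\<rho> * N\<close> exceeds \<open>1\<close>, the bound
      \<open>(\<rho> * N)^(1/2) < x\<close> keeps \<open>x\<close> above the left end
      \<open>N^(-1/2)\<close> of the base period.\<close>
    have "16 * (2/3) \<le> \<rho> * N" using N \<rho> mult_mono[of "2/3" \<rho> 16 "real N"] by auto
    then have "real N powr (-1/2) \<le> 1" "1 \<le> (\<rho> * N) powr (1/2)"
      using N powr_mono[of "-1/2" 0 "real N"] powr_mono[of 0 "1/2" "\<rho> * N"] by (auto split: if_splits)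
    then have "real N powr (-1/2) \<le> x" using assms by linarith
    then show ?thesis using kflat_base[of N x b] True N adm assms
      unfolding admissible_base_def Let_def by auto
  next
    case False
    define t where "t = x / N"
    have NN: "real N powr (1/2) = N * real N powr (-1/2)"
      using powr_add[of "real N" 1 "-1/2"] N by simp
    have t1: "real N powr (-1/2) \<le> t" using False Npos unfolding t_def NN by (simp add: field_simps)
    have t2: "t < (\<rho> * N) powr (-1/2)" using assms Npos unfolding t_def by (simp add: field_simps)
    have "16 * (2/3) \<le> \<rho> * N" using N \<rho> mult_mono[of "2/3" \<rho> 16 "real N"] by auto
    then have "(\<rho> * N) powr (-1/2) \<le> 1" using powr_mono[of "-1/2" 0 "\<rho> * N"] by (auto split: if_splits)
    moreover have "1 \<le> real N powr (1/2)" using N powr_mono[of 0 "1/2" "real N"] by auto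
    ultimately have t3: "t < real N powr (1/2)" using t2 by linarith
    have "b t = 1 / t" using t1 t2 adm unfolding admissible_base_def Let_def by auto
    moreover have "kflat N b x = real N powr (- 1) * kflat N b t"
      using kflat_scale[of N b 1 t] N by (simp add: t_def)
    ultimately show ?thesis using kflat_base[of N t b] t1 t3 N
      by (simp add: t_def powr_minus_divide)
  qed
qed

lemma kflat_flat:
  assumes "(\<rho>\<^sup>2 * N) powr (-1/2) \<le> x" "x \<le> (\<rho>\<^sup>2 * N) powr (1/2)"
  shows "kflat N b x = 1"
proof -
  have "\<rho>\<^sup>2 < 1\<^sup>2" by (rule power_strict_mono) (use \<rho> in auto)
  moreover have "\<rho> > 0" using \<rho> by auto
  ultimately have "\<rho>\<^sup>2 * N < real N" "0 < \<rho>\<^sup>2 * N" using N by auto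
  then have "(\<rho>\<^sup>2 * N) powr (1/2) < real N powr (1/2)" "real N powr (-1/2) < (\<rho>\<^sup>2 * N) powr (-1/2)"
    by (auto intro: powr_less_mono2 powr_less_mono2_neg)
  then show ?thesis using kflat_base[of N x b] N adm assms
    unfolding admissible_base_def Let_def by auto
qed

lemma C_infty_on_kflat: "C_infty_on (- {0}) (kflat N b)"
proof (rule C_infty_on_local)
  \<comment> \<open>Here a junction is represented by the right endpoint \<open>N^(1/2)\<close>,
    where the kernel is \<open>1/x\<close> on both sides; in the interior of the period the kernel
    is \<open>b\<close> itself.\<close>
  have base: "\<exists>U. open U \<and> t \<in> U \<and> C_infty_on U (kflat N b)"
    if t: "real N powr (-1/2) < t" "t \<le> real N powr (1/2)" for t
  proof (cases "t < real N powr (1/2)")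
    case True
    have "C_infty_on {real N powr (-1/2)<..<real N powr (1/2)} b"
      using adm unfolding admissible_base_def Let_def by auto
    then have "C_infty_on {real N powr (-1/2)<..<real N powr (1/2)} (kflat N b)"
      by (rule C_infty_on_cong) (use N in \<open>auto intro: kflat_base\<close>)
    then show ?thesis using True t by (intro exI[of _ "{real N powr (-1/2)<..<real N powr (1/2)}"]) auto
  next
    case False
    let ?U = "{(\<rho> * N) powr (1/2)<..<N * (\<rho> * N) powr (-1/2)}"
    have "C_infty_on ?U (\<lambda>x. 1 / x)"
      by (rule C_infty_on_subset[OF C_infty_on_inverse])
         (auto intro: le_less_trans[OF powr_ge_zero])
    then have "C_infty_on ?U (kflat N b)"
      by (rule C_infty_on_cong) (auto intro: kflat_near_junction)
    moreover have "real N powr (1/2) = N * real N powr (-1/2)"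
      using powr_add[of "real N" 1 "-1/2"] N by simp
    then have "t \<in> ?U" using False t rhoN_less N by auto
    ultimately show ?thesis by (intro exI[of _ ?U]) auto
  qed
  have sc: "\<exists>V. open V \<and> x \<in> V \<and> C_infty_on V (kflat N b)"
    if U: "open U" "c * x \<in> U" "C_infty_on U (kflat N b)"
      and c: "\<And>x. kflat N b x = c * kflat N b (c * x)" for U x c
  proof (intro exI[of _ "(\<lambda>x. c * x) -` U"] conjI)
    show "open ((\<lambda>x. c * x) -` U)" by (rule open_vimage[OF U(1)]) (intro continuous_intros)
    show "C_infty_on ((\<lambda>x. c * x) -` U) (kflat N b)"
      by (rule C_infty_on_cong[OF C_infty_on_rescale[OF U(3), of c]]) (rule c)
  qed (use U in auto)
  have pos: "\<exists>V. open V \<and> x \<in> V \<and> C_infty_on V (kflat N b)" if "x > 0" for x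
  proof -
    obtain m t where t: "real N powr (-1/2) \<le> t" "t < real N powr (1/2)" "x = real N powr real_of_int m * t"
      by (rule exists_scale[of N x]) (use N \<open>x > 0\<close> in auto)
    \<comment> \<open>A representative at the left end of its period is replaced by the right end of
      the previous one, so that \<open>base\<close> applies.\<close>
    obtain m t where t: "real N powr (-1/2) < t" "t \<le> real N powr (1/2)" "x = real N powr real_of_int m * t"
    proof (cases "real N powr (-1/2) < t")
      case True
      then show ?thesis using that[of t m] t by simp
    next
      case False
      show ?thesis
      proof (rule that[of "real N powr (1/2)" "m - 1"])
        have "real_of_int m - 1 + 1/2 = m + (-1/2)" by simp
        moreover have "t = real N powr (-1/2)" using False t by auto
        ultimately show "x = real N powr real_of_int (m - 1) * real N powr (1 / 2)"
          unfolding t(3) by (simp flip: powr_add)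
      qed (use N in auto)
    qed
    obtain U where U: "open U" "t \<in> U" "C_infty_on U (kflat N b)" using base t by blast
    have tx: "real N powr (- real_of_int m) * x = t" using N unfolding t(3) by (simp flip: mult.assoc powr_add)
    show ?thesis
    proof (rule sc[OF U(1) _ U(3)])
      show "real N powr (- real_of_int m) * x \<in> U" using U tx by simp
      show "kflat N b x = real N powr (- real_of_int m) * kflat N b (real N powr (- real_of_int m) * x)" for x
        using kflat_scale[of N b "-m" x] N by (simp flip: mult.assoc powr_add)
    qed
  qed
  fix x :: real assume "x \<in> - {0}"
  then consider "x > 0" | "x < 0" by fastforce
  then show "\<exists>V. open V \<and> x \<in> V \<and> C_infty_on V (kflat N b)"
  proof cases
    case 2
    then obtain U where "open U" "- x \<in> U" "C_infty_on U (kflat N b)" using pos[of "-x"] by auto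
    then show ?thesis using sc[of U "-1" x] by (simp add: kflat_minus)
  qed (rule pos)
qed

section \<open>Ellipticity and Calderon-Zygmund estimates\<close>

lemma kflat_deriv:
  "x \<noteq> 0 \<Longrightarrow> ((deriv ^^ n) (kflat N b) has_real_derivative (deriv ^^ Suc n) (kflat N b) x) (at x)"
  by (rule C_infty_on_higher_deriv[OF _ C_infty_on_kflat]) auto

text \<open>The product of \<open>\<bar>x\<bar>\<close> and \<open>\<bar>K x\<bar>\<close> is
  invariant under dilation, and on the base period it is \<open>b t * t\<close>, where both factors
  lie between \<open>N^(-1/2)\<close> and \<open>N^(1/2)\<close>.\<close>

lemma kflat_elliptic:
  assumes "x \<noteq> 0"
  shows "(1 / N) / \<bar>x\<bar> \<le> \<bar>kflat N b x\<bar>" "\<bar>kflat N b x\<bar> \<le> N / \<bar>x\<bar>"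
proof -
  have Npos: "real N > 0" using N by simp
  obtain m t where t: "real N powr (-1/2) \<le> t" "t < real N powr (1/2)" "\<bar>x\<bar> = real N powr real_of_int m * t"
    by (rule exists_scale[of N "\<bar>x\<bar>"]) (use N assms in auto)
  have "\<bar>kflat N b x\<bar> = \<bar>kflat N b \<bar>x\<bar>\<bar>" by (cases "x \<ge> 0") (auto simp: kflat_minus)
  also have "\<dots> = real N powr (- real_of_int m) * \<bar>b t\<bar>"
    unfolding t(3) using kflat_scale[of N b m t] kflat_base[of N t b] t N by (simp add: abs_mult)
  finally have "\<bar>kflat N b x\<bar> * \<bar>x\<bar> = \<bar>b t\<bar> * t"
    unfolding t(3) using Npos by (simp add: powr_minus_divide)
  moreover have bt: "real N powr (-1/2) \<le> b t" "b t \<le> real N powr (1/2)"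
    using admissible_bounds t by auto
  have t0: "t \<ge> 0" using t(1) powr_ge_zero[of "real N" "-1/2"] by linarith
  have bt0: "b t \<ge> 0" using bt(1) powr_ge_zero[of "real N" "-1/2"] by linarith
  moreover have p: "real N powr (-1/2) > 0" "real N powr (1/2) > 0" using Npos by auto
  ultimately have e: "\<bar>kflat N b x\<bar> * \<bar>x\<bar> = b t * t" by simp
  have "real N powr (-1/2) * real N powr (-1/2) \<le> b t * t" by (rule mult_mono) (use t bt bt0 t0 p in auto)
  moreover have "real N powr (-1/2) * real N powr (-1/2) = 1 / N"
    using Npos by (simp add: powr_minus_divide flip: powr_add)
  moreover have "b t * t \<le> real N powr (1/2) * real N powr (1/2)" by (rule mult_mono) (use t bt bt0 t0 p in auto)
  moreover have "real N powr (1/2) * real N powr (1/2) = N" using Npos by (simp flip: powr_add)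
  ultimately have "1 / N \<le> \<bar>kflat N b x\<bar> * \<bar>x\<bar>" "\<bar>kflat N b x\<bar> * \<bar>x\<bar> \<le> N"
    unfolding e by linarith+
  then show "(1 / N) / \<bar>x\<bar> \<le> \<bar>kflat N b x\<bar>" "\<bar>kflat N b x\<bar> \<le> N / \<bar>x\<bar>"
    using assms by (simp_all add: pos_divide_le_eq pos_le_divide_eq del: divide_divide_eq_left)
qed


text \<open>The derivative of order \<open>n\<close> is homogeneous of degree \<open>-(n+1)\<close>
  under dilations by powers of \<open>N\<close>, and it is continuous, hence bounded, on the compact
  closure of the base period.\<close>

lemma kflat_deriv_bound: 
  obtains C where "\<And>x. x \<noteq> 0 \<Longrightarrow> \<bar>(deriv ^^ n) (kflat N b) x\<bar> \<le> C / \<bar>x\<bar> ^ Suc n"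
proof -
  let ?K = "kflat N b"
  have sc: "(deriv ^^ n) ?K x = c ^ Suc n * (deriv ^^ n) ?K (c * x)"
    if c: "c \<noteq> 0" "\<And>x. ?K x = c * ?K (c * x)" and x: "x \<noteq> 0" for c x
    using x
  proof (induction n arbitrary: x)
    case 0
    show ?case using c(2)[of x] by simp
  next
    case (Suc n)
    have "((\<lambda>x. (deriv ^^ n) ?K (c * x)) has_real_derivative (deriv ^^ Suc n) ?K (c * x) * c) (at x)"
      by (rule DERIV_chain2[where g="\<lambda>x. c * x", OF kflat_deriv]) (use Suc.prems c(1) in \<open>auto intro!: derivative_eq_intros\<close>)
    from DERIV_cmult[OF this, of "c ^ Suc n"]
    have "((deriv ^^ n) ?K has_real_derivative c ^ Suc n * ((deriv ^^ Suc n) ?K (c * x) * c)) (at x)"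
      by (rule has_field_derivative_transform_within_open[of _ _ _ "- {0}"])
         (use Suc.prems Suc.IH[symmetric] in auto)
    from DERIV_unique[OF this kflat_deriv[OF Suc.prems]]
    have "(deriv ^^ Suc n) ?K x = c ^ Suc n * ((deriv ^^ Suc n) ?K (c * x) * c)" ..
    then show ?case by (simp only: power_Suc ac_simps)
  qed
  let ?I = "{real N powr (-1/2)..real N powr (1/2)}"
  have I: "0 < t" if "t \<in> ?I" for t using that N less_le_trans[of 0 "real N powr (-1/2)" t] by auto
  have "continuous_on ?I ((deriv ^^ n) ?K)"
    using DERIV_isCont[OF kflat_deriv] I by (force intro!: continuous_at_imp_continuous_on)
  then have "bounded ((deriv ^^ n) ?K ` ?I)" by (simp add: compact_continuous_image compact_imp_bounded)
  then obtain M where "\<forall>y \<in> (deriv ^^ n) ?K ` ?I. \<bar>y\<bar> \<le> M" unfolding bounded_real by blast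
  then have M: "\<bar>(deriv ^^ n) ?K t\<bar> \<le> M" if "t \<in> ?I" for t using that by blast
  show ?thesis
  proof (rule that[of "M * (real N powr (1/2)) ^ Suc n"])
    fix x :: real assume x: "x \<noteq> 0"
    obtain m t where t: "real N powr (-1/2) \<le> t" "t < real N powr (1/2)" "\<bar>x\<bar> = real N powr real_of_int m * t"
      by (rule exists_scale[of N "\<bar>x\<bar>"]) (use N x in auto)
    have tI: "t \<in> ?I" "t > 0" using t I by auto
    \<comment> \<open>The sign lets the reflection and the dilation act as a single factor, so
      negative \<open>x\<close> needs no separate estimate.\<close>
    define c where "c = sgn x * real N powr (- real_of_int m)"
    have cx: "c * x = t" unfolding c_def using t(3) N
      by (simp add: sgn_if powr_minus_divide field_simps abs_if split: if_splits)
    have c0: "c \<noteq> 0" using cx tI by auto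
    have "?K x = c * ?K (c * x)" for x
    proof (cases "sgn c = 1")
      case True
      then have "c = real N powr (real_of_int (-m))" unfolding c_def by (auto simp: sgn_if split: if_splits)
      then show ?thesis using kflat_scale[of N b "-m" x] N by (simp flip: mult.assoc powr_add)
    next
      case False
      then have "c = - (real N powr (real_of_int (-m)))" unfolding c_def using N x by (auto simp: sgn_if split: if_splits)
      then show ?thesis using kflat_scale[of N b "-m" x] N by (simp add: kflat_minus flip: mult.assoc powr_add)
    qed
    from sc[OF c0 this x] have "(deriv ^^ n) ?K x = c ^ Suc n * (deriv ^^ n) ?K t" unfolding cx .
    then have "\<bar>(deriv ^^ n) ?K x\<bar> * \<bar>x\<bar> ^ Suc n = \<bar>c * x\<bar> ^ Suc n * \<bar>(deriv ^^ n) ?K t\<bar>"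
      by (simp add: abs_mult power_abs power_mult_distrib mult_ac)
    also have "\<dots> \<le> (real N powr (1/2)) ^ Suc n * M"
      unfolding cx by (intro mult_mono power_mono M) (use tI in auto)
    finally show "\<bar>(deriv ^^ n) ?K x\<bar> \<le> M * (real N powr (1/2)) ^ Suc n / \<bar>x\<bar> ^ Suc n"
      using x by (simp add: pos_le_divide_eq mult_ac)
  qed
qed

text \<open>The kernel depends only on \<open>x - y\<close>, so both regularity conditions reduce to
  one Lipschitz estimate for \<open>K'\<close>, which the bound on \<open>K''\<close> gives. The
  exponent is \<open>\<delta> = 1\<close>.\<close>

lemma kflat_std_CZ: "std_CZ_kernel (\<lambda>x y. kflat N b (x - y))"
proof -
  let ?K = "kflat N b" and ?K' = "deriv (kflat N b)" and ?K'' = "deriv (deriv (kflat N b))"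
  obtain C1 where C1: "\<And>x. x \<noteq> 0 \<Longrightarrow> \<bar>?K' x\<bar> \<le> C1 / \<bar>x\<bar> ^ 2"
    using kflat_deriv_bound[of 1] by (auto simp: numeral_2_eq_2)
  obtain C2 where C2: "\<And>x. x \<noteq> 0 \<Longrightarrow> \<bar>?K'' x\<bar> \<le> C2 / \<bar>x\<bar> ^ 3"
    using kflat_deriv_bound[of 2] by (auto simp: numeral_2_eq_2 numeral_3_eq_3)
  have d1: "(?K has_real_derivative ?K' x) (at x)" if "x \<noteq> 0" for x
    using kflat_deriv[of x 0] that by simp
  have d2: "(?K' has_real_derivative ?K'' x) (at x)" if "x \<noteq> 0" for x
    using kflat_deriv[of x 1] that by simp
  have C0: "C1 \<ge> 0" "C2 \<ge> 0" using C1[of 1] C2[of 1] by auto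
  \<comment> \<open>The summands serve the size, gradient and regularity bounds. The gradient is a
    pair \<open>(a, -a)\<close>, of norm at most \<open>2 * \<bar>a\<bar>\<close>, which doubles
    \<open>C1\<close> and the constant \<open>8 * C2\<close> of \<open>hold\<close>.\<close>
  define C where "C = N + 2 * C1 + 16 * C2"
  have hold: "\<bar>?K' u - ?K' v\<bar> \<le> 8 * C2 * (\<bar>u - v\<bar> / \<bar>u\<bar>) / \<bar>u\<bar> ^ 2"
    if u: "u \<noteq> 0" "\<bar>u - v\<bar> \<le> \<bar>u\<bar> / 2" for u v
  proof -
    \<comment> \<open>The segment stays away from the singularity; the lost factor \<open>2\<close>,
      cubed, is the \<open>8\<close> in \<open>hold\<close>.\<close>
    have far: "\<bar>z\<bar> \<ge> \<bar>u\<bar> / 2" if "z \<in> closed_segment u v" for z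
    proof -
      have "\<bar>z - u\<bar> \<le> \<bar>v - u\<bar>" using segment_bound1[OF that] by simp
      then show ?thesis using u by arith
    qed
    have "norm (?K' u - ?K' v) \<le> C2 / (\<bar>u\<bar> / 2) ^ 3 * norm (u - v)"
    proof (rule field_differentiable_bound[of "closed_segment u v"])
      fix z assume z: "z \<in> closed_segment u v"
      then have "z \<noteq> 0" using far u by fastforce
      then show "(?K' has_field_derivative ?K'' z) (at z within closed_segment u v)"
        using d2 has_field_derivative_at_within by blast
      have "\<bar>?K'' z\<bar> \<le> C2 / \<bar>z\<bar> ^ 3" using C2 \<open>z \<noteq> 0\<close> by blast
      also have "\<dots> \<le> C2 / (\<bar>u\<bar> / 2) ^ 3"
        using far[OF z] C0 u by (intro divide_left_mono power_mono mult_pos_pos) (auto simp: \<open>z \<noteq> 0\<close>)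
      finally show "norm (?K'' z) \<le> C2 / (\<bar>u\<bar> / 2) ^ 3" by simp
    qed auto
    then show ?thesis using u by (simp add: field_simps power2_eq_square power3_eq_cube)
  qed
  have np: "norm (a, - a) \<le> 2 * \<bar>a\<bar>" for a :: real
    using norm_Pair_le[of a "-a"] by simp
  show ?thesis unfolding std_CZ_kernel_def
  proof (rule exI[of _ C], rule exI[of _ 1], rule exI[of _ "\<lambda>x y. (?K' (x - y), - ?K' (x - y))"], intro conjI allI impI)
    fix x y :: real assume xy: "x \<noteq> y"
    show "\<bar>?K (x - y)\<bar> \<le> C / \<bar>x - y\<bar>"
      by (rule order_trans[OF kflat_elliptic(2)])
         (use xy C0 in \<open>auto simp: C_def intro!: divide_right_mono\<close>)
    have "((\<lambda>p. ?K (fst p - snd p)) has_derivative (\<lambda>h. ?K' (x - y) * (fst h - snd h))) (at (x, y))"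
      using d1[of "x - y"] xy
      by (intro has_derivative_compose[of "\<lambda>p. fst p - snd p" "\<lambda>p. fst p - snd p" _ _ ?K "\<lambda>h. ?K' (x - y) * h", simplified])
         (auto intro!: derivative_eq_intros simp: has_field_derivative_def)
    then show "((\<lambda>p. ?K (fst p - snd p)) has_derivative
        (\<lambda>h. fst (?K' (x - y), - ?K' (x - y)) * fst h + snd (?K' (x - y), - ?K' (x - y)) * snd h)) (at (x, y))"
      by (simp add: algebra_simps)
    have "2 * \<bar>?K' (x - y)\<bar> \<le> 2 * (C1 / \<bar>x - y\<bar>\<^sup>2)" using C1[of "x - y"] xy by auto
    also have "\<dots> \<le> C / \<bar>x - y\<bar>\<^sup>2" using C0 by (auto simp: C_def intro!: divide_right_mono)
    finally show "norm (?K' (x - y), - ?K' (x - y)) \<le> C / \<bar>x - y\<bar>\<^sup>2" using np order_trans by blast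
  next
    have *: "norm ((?K' u, - ?K' u) - (?K' v, - ?K' v)) \<le> C * (\<bar>u - v\<bar> / \<bar>u\<bar>) powr 1 / \<bar>u\<bar>\<^sup>2"
      if "u \<noteq> 0" "\<bar>u - v\<bar> \<le> \<bar>u\<bar> / 2" for u v
    proof -
      have "norm ((?K' u, - ?K' u) - (?K' v, - ?K' v)) \<le> 2 * \<bar>?K' u - ?K' v\<bar>"
        using np[of "?K' u - ?K' v"] by simp
      also have "\<dots> \<le> 2 * (8 * C2 * (\<bar>u - v\<bar> / \<bar>u\<bar>) / \<bar>u\<bar> ^ 2)" using hold[OF that] by simp
      also have "\<dots> = (16 * C2) * (\<bar>u - v\<bar> / \<bar>u\<bar>) / \<bar>u\<bar> ^ 2" by simp
      also have "\<dots> \<le> C * (\<bar>u - v\<bar> / \<bar>u\<bar>) / \<bar>u\<bar> ^ 2"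
        by (intro divide_right_mono mult_right_mono) (use C0 in \<open>auto simp: C_def\<close>)
      finally show ?thesis by simp
    qed
    show "norm ((?K' (x - y), - ?K' (x - y)) - (?K' (x' - y), - ?K' (x' - y)))
      \<le> C * (\<bar>x - x'\<bar> / \<bar>x - y\<bar>) powr 1 / \<bar>x - y\<bar>\<^sup>2"
      if "x \<noteq> y \<and> \<bar>x - x'\<bar> \<le> \<bar>x - y\<bar> / 2" for x x' y
      using *[of "x - y" "x' - y"] that by auto
    show "norm ((?K' (x - y), - ?K' (x - y)) - (?K' (x - y'), - ?K' (x - y')))
      \<le> C * (\<bar>y - y'\<bar> / \<bar>x - y\<bar>) powr 1 / \<bar>x - y\<bar>\<^sup>2"
      if "x \<noteq> y \<and> \<bar>y - y'\<bar> \<le> \<bar>x - y\<bar> / 2" for x y y'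
      using *[of "x - y" "x - y'"] that by (auto simp: abs_minus_commute)
  qed simp
qed

lemma kflat_borel_measurable: "kflat N b \<in> borel_measurable borel"
proof (rule borel_measurable_continuous_countable_exceptions[of "{0}"])
  show "continuous_on (- {0}) (kflat N b)"
    using DERIV_isCont[OF kflat_deriv[of _ 0]] by (auto intro!: continuous_at_imp_continuous_on)
qed simp

end

text \<open>Homogeneity moves the flat zone of \<open>b\<close> to scale \<open>N^(-k)\<close>. At
  scale \<open>1\<close> it contains \<open>[3/8, 1]\<close>, because
  \<open>\<rho> \<ge> 2/3\<close> and \<open>N \<ge> 16\<close> give
  \<open>\<rho>\<^sup>2 * N \<ge> (8/3)\<^sup>2\<close>. This range covers the distances in
  \<open>cint_children_dist\<close> and \<open>Lint_dist\<close>.\<close>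

lemma kflat_middle:
  assumes "N \<ge> 16" "2/3 \<le> \<rho>" "\<rho> < 1" "admissible_base N \<rho> b"
    and u: "3 / 8 * (1 / real N) ^ k \<le> u" "u \<le> (1 / real N) ^ k"
  shows "kflat N b u = real N ^ k"
proof -
  have N: "real N \<ge> 16" using assms(1) by simp
  have Nk: "real N powr (- real_of_int (- int k)) = real N ^ k" using N by (simp add: powr_realpow)
  define t where "t = real N ^ k * u"
  have t: "3/8 \<le> t" "t \<le> 1" using u N unfolding t_def by (auto simp: field_simps)
  have u: "u = real N powr (real_of_int (- int k)) * t"
    using N unfolding t_def by (simp add: powr_minus powr_realpow)
  have "(2/3)\<^sup>2 \<le> \<rho>\<^sup>2" using assms(2) by (intro power_mono) auto
  then have "(2/3)\<^sup>2 * 16 \<le> \<rho>\<^sup>2 * N" using N by (intro mult_mono) auto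
  then have r: "(8/3)\<^sup>2 \<le> \<rho>\<^sup>2 * N" by (simp add: power2_eq_square)
  then have s: "8/3 \<le> sqrt (\<rho>\<^sup>2 * N)" by (rule real_le_rsqrt)
  have p1: "(\<rho>\<^sup>2 * N) powr (1/2) = sqrt (\<rho>\<^sup>2 * N)" by (rule powr_half_sqrt) simp
  have "(\<rho>\<^sup>2 * N) powr (-1/2) = inverse ((\<rho>\<^sup>2 * N) powr (1/2))"
    using powr_minus[of "\<rho>\<^sup>2 * N" "1/2"] by simp
  also have "\<dots> \<le> 3/8" unfolding p1 using le_imp_inverse_le[OF s] by simp
  finally have "kflat N b t = 1"
    using kflat_flat[OF assms(1-4), of t] t s p1 by linarith
  then show ?thesis
    using kflat_scale[of N b "- int k" t] Nk assms(1) unfolding u by simp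
qed

subsection \<open>Geometry of the Cantor intervals\<close>

context
  fixes N :: nat
  assumes N: "N \<ge> 16"
begin

lemma scale_pos: "0 < (1 / real N) ^ k"
  using N by simp

lemma scale_Suc: "(1 / real N) ^ Suc k \<le> (1 / real N) ^ k / 16"
proof -
  have "(1 / real N) * (1 / real N) ^ k \<le> (1/16) * (1 / real N) ^ k"
    using N by (intro mult_right_mono) (auto simp: field_simps)
  then show ?thesis by simp
qed

lemma cint_iff: "x \<in> cint N k j \<longleftrightarrow> cleft N k j \<le> x \<and> x \<le> cleft N k j + (1 / real N) ^ k"
  by (simp add: cint_def)

lemma cleft_children:
  "cleft N (Suc k) (2 * j) = cleft N k j"
  "cleft N (Suc k) (Suc (2 * j)) = cleft N k j + (1 / real N) ^ k - (1 / real N) ^ Suc k"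
  by auto

lemma cint_Suc_subset: "cint N (Suc k) j \<subseteq> cint N k (j div 2)"
  using scale_Suc[of k] scale_pos[of k] by (auto simp: cint_iff simp del: power_Suc split: if_splits)

text \<open>Each child has at most \<open>1/16\<close> of the length of its parent, which leaves at
  least \<open>1 - 2/16 = 7/8\<close> for the gap. Hence the kernel is flat across it.\<close>

lemma cint_children_dist:
  assumes "x \<in> cint N (Suc k) (2 * j)" "y \<in> cint N (Suc k) (Suc (2 * j))"
  shows "7 / 8 * (1 / real N) ^ k \<le> y - x" "y - x \<le> (1 / real N) ^ k"
  using assms scale_Suc[of k] unfolding cint_iff cleft_children by linarith+

lemma cint_sibling_disjoint: "cint N (Suc k) (2 * j) \<inter> cint N (Suc k) (Suc (2 * j)) = {}"
  using cint_children_dist[of _ k j] scale_pos[of k] by force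

lemma cint_disjoint:
  assumes "i < 2 ^ k" "j < 2 ^ k" "i \<noteq> j"
  shows "cint N k i \<inter> cint N k j = {}"
  using assms
proof (induction k arbitrary: i j)
  case (Suc k)
  show ?case
  proof (cases "i div 2 = j div 2")
    case False
    have "i div 2 < 2 ^ k" "j div 2 < 2 ^ k" using Suc.prems by auto
    then have "cint N k (i div 2) \<inter> cint N k (j div 2) = {}" using Suc.IH False by blast
    then show ?thesis using cint_Suc_subset by blast
  next
    case True
    then consider "i = 2 * (j div 2)" "j = Suc (2 * (j div 2))" | "j = 2 * (j div 2)" "i = Suc (2 * (j div 2))"
      using Suc.prems(3) by linarith
    then show ?thesis using cint_sibling_disjoint[of k "j div 2"] by cases (metis, metis Int_commute)
  qed
qed simp

lemma cantor_set_cint: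
  assumes "x \<in> cantor_set N"
  obtains j where "j < 2 ^ k" "x \<in> cint N k j"
  using assms unfolding cantor_set_def by auto

lemma cantor_set_child:
  assumes "x \<in> cantor_set N" "j < 2 ^ k" "x \<in> cint N k j"
  shows "x \<in> cint N (Suc k) (2 * j) \<or> x \<in> cint N (Suc k) (Suc (2 * j))"
proof -
  obtain i where i: "i < 2 ^ Suc k" "x \<in> cint N (Suc k) i" using cantor_set_cint[OF assms(1)] .
  then have "i div 2 < 2 ^ k" "x \<in> cint N k (i div 2)" using cint_Suc_subset by auto
  then have "i div 2 = j" using cint_disjoint[of "i div 2" k j] assms by blast
  then have "i = 2 * j \<or> i = Suc (2 * j)" by linarith
  then show ?thesis using i by blast
qed

text \<open>From the center to an endpoint is \<open>1/2\<close> of the length; half of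
  \<open>Lint\<close> and a whole child cost at most \<open>1/16\<close> each, and
  \<open>1/2 - 2/16 = 3/8\<close>.\<close>

lemma Lint_dist:
  assumes "y \<in> Lint N k j"
  shows "x \<in> cint N (Suc k) (2 * j) \<Longrightarrow> 3 / 8 * (1 / real N) ^ k \<le> y - x \<and> y - x \<le> (1 / real N) ^ k"
    and "x \<in> cint N (Suc k) (Suc (2 * j)) \<Longrightarrow> 3 / 8 * (1 / real N) ^ k \<le> x - y \<and> x - y \<le> (1 / real N) ^ k"
  using assms scale_Suc[of k] unfolding cint_iff cleft_children Lint_def ccenter_def atLeastAtMost_iff
  by linarith+

lemma Lint_subset_cint: "Lint N k j \<subseteq> cint N k j"
  using scale_Suc[of k] scale_pos[of k] unfolding Lint_def ccenter_def cint_def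
  by (intro atLeastatMost_subset_iff[THEN iffD2] disjI2 conjI) linarith+

lemma Lint_disjoint_children:
  "Lint N k j \<inter> cint N (Suc k) (2 * j) = {}" "Lint N k j \<inter> cint N (Suc k) (Suc (2 * j)) = {}"
  using Lint_dist[of _ k j] scale_pos[of k] by force+

end

subsection \<open>The operator on the tree of Cantor intervals\<close>

text \<open>A sum over the interval and its ancestors below the root: each contributes the mass of
  its sibling, with index \<open>j - 1\<close> or \<open>Suc j\<close>, times the flat value of the
  kernel across the gap of their parent. The sign is positive when the sibling lies to the
  left.\<close>

fun outer :: "nat \<Rightarrow> (nat \<Rightarrow> nat \<Rightarrow> real) \<Rightarrow> nat \<Rightarrow> nat \<Rightarrow> real" where
  "outer N A 0 j = 0"
| "outer N A (Suc k) j = outer N A k (j div 2) +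
     (if odd j then real N ^ k * A (Suc k) (j - 1) else - (real N ^ k * A (Suc k) (Suc j)))"

text \<open>The value of \<open>H\<close> on \<open>Lint N k j\<close> if \<open>A\<close> lists the
  masses on the Cantor intervals. The first term comes from the two children, \<open>outer\<close>
  from everything outside the interval.\<close>

definition tree_op :: "nat \<Rightarrow> (nat \<Rightarrow> nat \<Rightarrow> real) \<Rightarrow> nat \<Rightarrow> nat \<Rightarrow> real" where
  "tree_op N A k j = real N ^ k * (A (Suc k) (2 * j) - A (Suc k) (Suc (2 * j))) + outer N A k j"

text \<open>The case of a unit mass at \<open>x\<close>. In the smallest Cantor interval containing
  both points, \<open>y - x\<close> lies in the flat zone of that scale, so the kernel only records
  this scale and the order of the points.\<close>

lemma kflat_eq_tree_op:
  assumes N: "N \<ge> 16" and \<rho>: "2/3 \<le> \<rho>" "\<rho> < 1" and adm: "admissible_base N \<rho> b"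
    and x: "x \<in> cantor_set N" and j: "j < 2 ^ k" and y: "y \<in> Lint N k j"
  shows "kflat N b (y - x) = tree_op N (\<lambda>k j. indicator (cint N k j) x) k j"
proof -
  let ?I = "\<lambda>k j. indicator (cint N k j) x :: real"
  note mid = kflat_middle[OF N \<rho> adm]
  note sub = cint_Suc_subset[OF N]
  have mid': "kflat N b u = - (real N ^ k)"
    if "3 / 8 * (1 / real N) ^ k \<le> - u" "- u \<le> (1 / real N) ^ k" for u k
    using mid[OF that] kflat_minus[of N b u] by simp
  \<comment> \<open>An interval containing \<open>x\<close> excludes \<open>x\<close> from its own
    sibling and from those of its ancestors, so every term vanishes.\<close>
  have inner: "outer N ?I k j = 0" if "j < 2 ^ k" "x \<in> cint N k j" for k j
    using that
  proof (induction k arbitrary: j)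
    case (Suc k)
    have "outer N ?I k (j div 2) = 0" by (rule Suc.IH) (use Suc.prems sub in auto)
    moreover have "x \<notin> cint N (Suc k) (j - 1)" if "odd j"
      using that Suc.prems cint_disjoint[OF N, of "j - 1" "Suc k" j] by (cases j) auto
    moreover have "x \<notin> cint N (Suc k) (Suc j)" if "even j"
    proof -
      have "Suc j < 2 ^ Suc k" using that Suc.prems(1) by (metis Suc_lessI even_Suc even_power power_Suc dvd_triv_left)
      then show ?thesis using Suc.prems cint_disjoint[OF N, of "Suc j" "Suc k" j] by auto
    qed
    ultimately show ?case by auto
  qed simp
  \<comment> \<open>The induction locates the generation where \<open>x\<close> and \<open>y\<close>
    separate. If the parent contains \<open>x\<close>, then \<open>x\<close> is in the sibling and
    only the last term survives; otherwise the last term is zero and the parent satisfies the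
    induction hypothesis.\<close>
  have outside: "kflat N b (y - x) = outer N ?I k j" if "j < 2 ^ k" "x \<notin> cint N k j" "y \<in> cint N k j" for k j
    using that
  proof (induction k arbitrary: j)
    case 0
    obtain i where "i < 2 ^ 0" "x \<in> cint N 0 i" using cantor_set_cint[OF N x] .
    then show ?case using 0 by simp
  next
    case (Suc k)
    define i where "i = j div 2"
    have i: "i < 2 ^ k" using Suc.prems i_def by auto
    have h: "0 < (1 / real N) ^ k" using scale_pos[OF N] .
    consider (l) "j = 2 * i" | (r) "j = Suc (2 * i)" unfolding i_def by linarith
    then show ?case
    proof cases
      case l
      show ?thesis
      proof (cases "x \<in> cint N k i")
        case True
        then have "x \<in> cint N (Suc k) (Suc (2 * i))" using cantor_set_child[OF N x i] Suc.prems l by auto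
        then show ?thesis using inner[OF i True] cint_children_dist[OF N, of y k i x] Suc.prems h
          by (subst mid'[of k]) (auto simp: l simp del: cleft.simps)
      next
        case False
        have "x \<notin> cint N (Suc k) (Suc (2 * i))" using False sub[of k "Suc (2 * i)"] by auto
        moreover have "y \<in> cint N k i" using Suc.prems sub l by force
        ultimately show ?thesis using Suc.IH[OF i False] l by simp
      qed
    next
      case r
      show ?thesis
      proof (cases "x \<in> cint N k i")
        case True
        then have "x \<in> cint N (Suc k) (2 * i)" using cantor_set_child[OF N x i] Suc.prems r by auto
        then show ?thesis using inner[OF i True] cint_children_dist[OF N, of x k i y] Suc.prems h
          by (subst mid[of k]) (auto simp: r simp del: cleft.simps)
      next
        case False
        have "x \<notin> cint N (Suc k) (2 * i)" using False sub[of k "2 * i"] by auto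
        moreover have "y \<in> cint N k i" using Suc.prems sub r by force
        ultimately show ?thesis using Suc.IH[OF i False] r by simp
      qed
    qed
  qed
  show ?thesis
  proof (cases "x \<in> cint N k j")
    case True
    note o = inner[OF j True]
    have "x \<in> cint N (Suc k) (2 * j) \<or> x \<in> cint N (Suc k) (Suc (2 * j))"
      using cantor_set_child[OF N x j True] .
    then show ?thesis
    proof
      assume l: "x \<in> cint N (Suc k) (2 * j)"
      then have "x \<notin> cint N (Suc k) (Suc (2 * j))" using cint_sibling_disjoint[OF N] by blast
      then show ?thesis using mid[of k "y - x"] Lint_dist(1)[OF N y l] l o by (simp add: tree_op_def)
    next
      assume r: "x \<in> cint N (Suc k) (Suc (2 * j))"
      then have "x \<notin> cint N (Suc k) (2 * j)" using cint_sibling_disjoint[OF N] by blast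
      then show ?thesis using mid'[of k "y - x"] Lint_dist(2)[OF N y r] r o by (simp add: tree_op_def)
    qed
  next
    case False
    have "y \<in> cint N k j" using y Lint_subset_cint[OF N] by blast
    moreover have "x \<notin> cint N (Suc k) (2 * j)" "x \<notin> cint N (Suc k) (Suc (2 * j))"
      using False sub[of k "2 * j"] sub[of k "Suc (2 * j)"] by auto
    ultimately show ?thesis using outside[OF j False] by (simp add: tree_op_def)
  qed
qed

section \<open>The square sum estimate on the tree\<close>

lemma sum_pairs: "(\<Sum>j<2 * n. f j) = (\<Sum>j<n. f (2 * j) + f (Suc (2 * j)) :: real)"
  by (induction n) auto

lemma omega_w_pos: "N \<ge> 16 \<Longrightarrow> omega_w N k j > 0"
  by (induction k arbitrary: j) (auto intro!: mult_pos_pos add_pos_nonneg)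

lemma omega_w_Suc_ge:
  assumes "N \<ge> 16"
  shows "15 / 32 * omega_w N k (j div 2) \<le> omega_w N (Suc k) j"
proof -
  have "(1 - 1 / real N) / 2 \<ge> 15 / 32" "(1 + 1 / real N) / 2 \<ge> 15 / 32" using assms by (auto simp: field_simps)
  then have "15/32 \<le> (if k = 0 then 1 / 2 else if even j = even (j div 2) then (1 + 1 / real N) / 2
      else (1 - 1 / real N) / 2)" by auto
  from mult_left_mono[OF this less_imp_le[OF omega_w_pos[OF assms, of k "j div 2"]]]
  show ?thesis by (simp add: mult.commute)
qed

text \<open>The difference of the shares of the left and the right child: it favors the left child
  of a left child and the right child of a right child, and vanishes at the root, which is split
  evenly.\<close>

definition omega_bias :: "nat \<Rightarrow> nat \<Rightarrow> nat \<Rightarrow> real" where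
  "omega_bias N k j = (if k = 0 then 0 else if even j then 1 / N else - 1 / N)"

lemma omega_w_children:
  "omega_w N (Suc k) (2 * j) = omega_w N k j * (1 + omega_bias N k j) / 2"
  "omega_w N (Suc k) (Suc (2 * j)) = omega_w N k j * (1 - omega_bias N k j) / 2"
  by (auto simp: omega_bias_def)

text \<open>Up to the factor $2$, the deviation of the mass \<open>A\<close> of the left child from its share
  under the redistributed measure.\<close>
definition tree_diff :: "nat \<Rightarrow> (nat \<Rightarrow> nat \<Rightarrow> real) \<Rightarrow> nat \<Rightarrow> nat \<Rightarrow> real" where
  "tree_diff N A k j = A (Suc k) (2 * j) - A (Suc k) (Suc (2 * j)) - omega_bias N k j * A k j"

context
  fixes N :: nat and A :: "nat \<Rightarrow> nat \<Rightarrow> real"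
  assumes N: "N \<ge> 16" and add: "\<And>k j. j < 2 ^ k \<Longrightarrow> A k j = A (Suc k) (2 * j) + A (Suc k) (Suc (2 * j))"
begin

text \<open>Passing to a child \<open>J\<close> keeps the term of its sibling and loses the term of
  \<open>J\<close> itself, which is \<open>N^k * A J\<close> up to sign. This is exactly
  \<open>N^(k+1)\<close> times the bias times \<open>A J\<close>, which explains the choice
  \<open>1/N\<close> for the redistribution.\<close>

lemma tree_op_Suc:
  assumes "i < 2 ^ Suc k"
  shows "tree_op N A (Suc k) i = tree_op N A k (i div 2) + real N ^ Suc k * tree_diff N A (Suc k) i"
proof -
  define j where "j = i div 2"
  have "i = 2 * j \<or> i = Suc (2 * j)" unfolding j_def by linarith
  moreover have "j < 2 ^ k" using assms unfolding j_def by auto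
  ultimately show ?thesis using N add[of j k]
    by (auto simp: tree_op_def tree_diff_def omega_bias_def algebra_simps)
qed

lemma tree_op_0: "tree_op N A 0 0 = tree_diff N A 0 0"
  by (simp add: tree_op_def tree_diff_def omega_bias_def)

text \<open>With \<open>t\<close> the bias and \<open>w\<close> the mass of the interval, the right
  side equals the square of \<open>tree_diff\<close> over \<open>w * (1 - t\<^sup>2)\<close>, as for
  the variance of a two-valued function; and \<open>1 - t\<^sup>2 \<le> 1\<close>.\<close>

lemma tree_diff_le:
  assumes j: "j < 2 ^ k"
  shows "(tree_diff N A k j)\<^sup>2 / omega_w N k j \<le> (A (Suc k) (2 * j))\<^sup>2 / omega_w N (Suc k) (2 * j)
    + (A (Suc k) (Suc (2 * j)))\<^sup>2 / omega_w N (Suc k) (Suc (2 * j)) - (A k j)\<^sup>2 / omega_w N k j"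
proof -
  define u v t w where "u = A (Suc k) (2 * j)" and "v = A (Suc k) (Suc (2 * j))"
    and "t = omega_bias N k j" and "w = omega_w N k j"
  have w: "w > 0" using omega_w_pos[OF N] by (simp add: w_def)
  have t: "\<bar>t\<bar> < 1" using N by (auto simp: t_def omega_bias_def)
  then have t2: "0 < 1 - t\<^sup>2" "1 - t\<^sup>2 \<le> 1" "1 + t > 0" "1 - t > 0" by (auto simp: abs_square_less_1)
  have "2 * u\<^sup>2 / (w * (1 + t)) + 2 * v\<^sup>2 / (w * (1 - t)) - (u + v)\<^sup>2 / w = (u - v - t * (u + v))\<^sup>2 / (w * (1 - t\<^sup>2))"
  proof -
    have f: "1 - t\<^sup>2 = (1 + t) * (1 - t)" by (simp add: power2_eq_square algebra_simps)
    show ?thesis unfolding f using t2 w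
      by (simp add: divide_simps) (simp add: power2_eq_square algebra_simps)
  qed
  moreover have "(u - v - t * (u + v))\<^sup>2 / w \<le> (u - v - t * (u + v))\<^sup>2 / (w * (1 - t\<^sup>2))"
    using t2 w by (intro divide_left_mono) auto
  ultimately show ?thesis
    unfolding tree_diff_def add[OF j] omega_w_children u_def[symmetric] v_def[symmetric]
      t_def[symmetric] w_def[symmetric] by (simp add: mult.commute)
qed

text \<open>The factor \<open>1/N\<close> in the recursion for \<open>q\<close> outweighs both the
  doubling of the number of intervals and the decrease of the weights, so \<open>S\<close> contracts
  up to the terms \<open>V\<close>, whose sum telescopes. Generation \<open>n\<close> suffices for
  all \<open>k < n\<close> because \<open>tree_op\<close> looks one generation ahead.\<close>

lemma tree_op_square_sum:
  "(\<Sum>k<n. \<Sum>j<2^k. (tree_op N A k j / real N ^ k)\<^sup>2 / omega_w N k j)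
     \<le> 3 * (\<Sum>j<2^n. (A n j)\<^sup>2 / omega_w N n j)"
proof -
  define q where "q k j = tree_op N A k j / real N ^ k" for k j
  define S where "S k = (\<Sum>j<2^k. (q k j)\<^sup>2 / omega_w N k j)" for k
  define V where "V k = (\<Sum>j<2^k. (tree_diff N A k j)\<^sup>2 / omega_w N k j)" for k
  define Q where "Q k = (\<Sum>j<2^k. (A k j)\<^sup>2 / omega_w N k j)" for k
  note wpos = omega_w_pos[OF N]
  have S0: "S k \<ge> 0" for k unfolding S_def using wpos by (intro sum_nonneg divide_nonneg_pos) auto
  have Q0: "Q k \<ge> 0" for k unfolding Q_def using wpos by (intro sum_nonneg divide_nonneg_pos) auto
  have VQ: "V k \<le> Q (Suc k) - Q k" for k
    unfolding V_def Q_def power_Suc sum_pairs sum_subtractf[symmetric]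
    by (intro sum_mono tree_diff_le) auto
  have qS: "q (Suc k) i = q k (i div 2) / N + tree_diff N A (Suc k) i" if "i < 2 ^ Suc k" for k i
    using N unfolding q_def tree_op_Suc[OF that] by (simp add: field_simps)
  have step: "S (Suc k) \<le> S k / 4 + 2 * V (Suc k)" for k
  proof -
    \<comment> \<open>From \<open>N \<ge> 16\<close> the coefficient is
      \<open>2/256 = 1/128\<close>, and the change of weight costs \<open>32/15\<close>, together
      less than \<open>1/8\<close>. Two children per interval then give \<open>1/4\<close>.\<close>
    have "(q (Suc k) i)\<^sup>2 / omega_w N (Suc k) i \<le> (q k (i div 2))\<^sup>2 / omega_w N k (i div 2) / 8
        + 2 * ((tree_diff N A (Suc k) i)\<^sup>2 / omega_w N (Suc k) i)" if i: "i < 2 ^ Suc k" for i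
    proof -
      define x d w v where "x = q k (i div 2)" and "d = tree_diff N A (Suc k) i"
        and "w = omega_w N (Suc k) i" and "v = omega_w N k (i div 2)"
      have p: "w > 0" "v > 0" "15/32 * v \<le> w" unfolding w_def v_def by (rule wpos omega_w_Suc_ge[OF N])+
      have "(x / N)\<^sup>2 \<le> x\<^sup>2 / 256"
      proof -
        have "16 ^ 2 \<le> real N ^ 2" using N by (intro power_mono) auto
        then show ?thesis unfolding power_divide by (intro divide_left_mono) (use N in auto)
      qed
      moreover have "(x / N + d)\<^sup>2 \<le> 2 * (x / N)\<^sup>2 + 2 * d\<^sup>2"
        using sum_squares_bound[of "x / N" d] by (simp add: power2_sum)
      ultimately have "(x / N + d)\<^sup>2 \<le> x\<^sup>2 / 128 + 2 * d\<^sup>2" by simp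
      then have "(x / N + d)\<^sup>2 / w \<le> (x\<^sup>2 / 128 + 2 * d\<^sup>2) / w" using p by (intro divide_right_mono) auto
      also have "\<dots> = x\<^sup>2 / 128 / w + 2 * (d\<^sup>2 / w)" by (simp add: add_divide_distrib)
      also have "x\<^sup>2 / 128 / w \<le> x\<^sup>2 / 128 / (15/32 * v)" using p by (intro divide_left_mono mult_pos_pos) auto
      also have "\<dots> \<le> x\<^sup>2 / v / 8" using p by (simp add: field_simps)
      finally show ?thesis unfolding qS[OF i] x_def d_def w_def v_def by simp
    qed
    then have "S (Suc k) \<le> (\<Sum>i<2 ^ Suc k. (q k (i div 2))\<^sup>2 / omega_w N k (i div 2) / 8
        + 2 * ((tree_diff N A (Suc k) i)\<^sup>2 / omega_w N (Suc k) i))"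
      unfolding S_def by (intro sum_mono) auto
    also have "\<dots> = (\<Sum>i<2 * 2 ^ k. (q k (i div 2))\<^sup>2 / omega_w N k (i div 2) / 8) + 2 * V (Suc k)"
      unfolding V_def sum.distrib sum_distrib_left power_Suc ..
    also have "(\<Sum>i<2 * 2 ^ k. (q k (i div 2))\<^sup>2 / omega_w N k (i div 2) / 8) = S k / 4"
      unfolding sum_pairs S_def by (simp add: sum_divide_distrib mult.commute)
    finally show ?thesis .
  qed
  \<comment> \<open>The sum on the right stops one generation earlier, so that \<open>step\<close>
    advances the induction. Absorbing it on the left afterwards gives \<open>8/3\<close>, rounded up
    to \<open>3\<close>.\<close>
  have "(\<Sum>k<Suc n. S k) \<le> (\<Sum>k<n. S k) / 4 + 2 * (Q (Suc n) - Q 0)" for n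
  proof (induction n)
    case 0
    have "S 0 = V 0" unfolding S_def V_def q_def by (simp add: tree_op_0)
    then show ?case using VQ[of 0] S0[of 0] by simp
  next
    case (Suc n)
    have "p + s + s' \<le> (p + s) / 4 + 2 * (q'' - q)"
      if "p + s \<le> p / 4 + 2 * (q' - q)" "s' \<le> s / 4 + 2 * v" "v \<le> q'' - q'" for p s s' v q q' q'' :: real
      using that by argo
    from this[OF _ step[of n] VQ[of "Suc n"]] Suc show ?case unfolding sum.lessThan_Suc by blast
  qed
  then have "(\<Sum>k<n. S k) \<le> 3 * Q n" for n
  proof (cases n)
    case (Suc m)
    have "(\<Sum>k<m. S k) \<le> (\<Sum>k<Suc m. S k)" using S0[of m] by simp
    moreover have "0 \<le> (\<Sum>k<Suc m. S k)" using S0 by (intro sum_nonneg) auto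
    ultimately show ?thesis
      using \<open>(\<Sum>k<Suc m. S k) \<le> (\<Sum>k<m. S k) / 4 + 2 * (Q (Suc m) - Q 0)\<close> Q0[of 0] Q0[of n]
      unfolding Suc by argo
  qed (use Q0 in simp)
  then show ?thesis unfolding S_def Q_def q_def .
qed

end

subsection \<open>Boundedness of the operator\<close>

lemma nn_integral_sigma_hat:
  assumes [measurable]: "f \<in> borel_measurable borel"
  shows "(\<integral>\<^sup>+ y. f y \<partial>sigma_hat N) = (\<Sum>k. \<Sum>j<2^k.
    ennreal (s_hat N k j / (2 * (1 / real N) ^ Suc k)) * (\<integral>\<^sup>+ y\<in>Lint N k j. f y \<partial>lborel))"
proof -
  have [measurable]: "Lint N k j \<in> sets borel" for k j by (simp add: Lint_def)
  have "(\<integral>\<^sup>+ y. f y \<partial>sigma_hat N) = (\<integral>\<^sup>+ y. (\<Sum>k. \<Sum>j<2^k.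
      ennreal (s_hat N k j / (2 * (1 / real N) ^ Suc k)) * indicator (Lint N k j) y) * f y \<partial>lborel)"
    unfolding sigma_hat_def by (subst nn_integral_density; measurable)
  also have "\<dots> = (\<integral>\<^sup>+ y. (\<Sum>k. \<Sum>j<2^k.
      ennreal (s_hat N k j / (2 * (1 / real N) ^ Suc k)) * (f y * indicator (Lint N k j) y)) \<partial>lborel)"
    by (simp only: ennreal_suminf_multc[symmetric] sum_distrib_right mult.assoc
        mult.commute[of "indicator (Lint N _ _) _" "f _"])
  also have "\<dots> = (\<Sum>k. \<Sum>j<2^k.
    ennreal (s_hat N k j / (2 * (1 / real N) ^ Suc k)) * (\<integral>\<^sup>+ y\<in>Lint N k j. f y \<partial>lborel))"
    by (subst nn_integral_suminf, measurable)
      (simp add: nn_integral_sum nn_integral_cmult del: power_Suc)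
  finally show ?thesis .
qed

lemma emeasure_Lint:
  assumes "N \<ge> 16"
  shows "emeasure lborel (Lint N k j) = ennreal (2 * (1 / real N) ^ Suc k)"
  unfolding Lint_def by (subst emeasure_lborel_Icc) auto

section \<open>Masses of \<open>g \<omega>\<close> and the bound for the operator\<close>

context
  fixes N :: nat and \<omega> :: "real measure"
  assumes N: "N \<ge> 16" and \<omega>: "redistributed_cantor N \<omega>"
begin

lemma sets_omega [measurable_cong]: "sets \<omega> = sets borel"
  using \<omega> by (simp add: redistributed_cantor_def)

lemma space_omega: "space \<omega> = UNIV"
  using sets_eq_imp_space_eq[OF sets_omega] by simp

lemma emeasure_omega_UNIV: "emeasure \<omega> UNIV = 1"
  using \<omega> space_omega by (simp add: redistributed_cantor_def)

lemma finite_measure_omega: "finite_measure \<omega>"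
  by (rule finite_measureI) (simp add: space_omega emeasure_omega_UNIV)

lemma cint_measurable [measurable]: "cint N k j \<in> sets borel"
  by (simp add: cint_def)

lemma emeasure_cint: "j < 2 ^ k \<Longrightarrow> emeasure \<omega> (cint N k j) = ennreal (omega_w N k j)"
  using \<omega> by (simp add: redistributed_cantor_def)

lemma measure_cint: "j < 2 ^ k \<Longrightarrow> measure \<omega> (cint N k j) = omega_w N k j"
  using emeasure_cint[of j k] omega_w_pos[OF N, of k j] by (simp add: measure_def)

lemma AE_cantor_set: "AE x in \<omega>. x \<in> cantor_set N"
proof (rule AE_I[of _ _ "- cantor_set N"])
  show "- cantor_set N \<in> sets \<omega>" unfolding cantor_set_def by measurable
  show "emeasure \<omega> (- cantor_set N) = 0" using \<omega> by (simp add: redistributed_cantor_def)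
qed auto

context
  fixes g :: "real \<Rightarrow> real"
  assumes g [measurable]: "g \<in> borel_measurable borel"
    and g2: "(\<integral>\<^sup>+ x. ennreal ((g x)\<^sup>2) \<partial>\<omega>) < \<infinity>"
begin

lemma integrable_square: "integrable \<omega> (\<lambda>x. (g x)\<^sup>2)"
  by (rule integrableI_nonneg) (use g2 in auto)

lemma integrable_L2: "integrable \<omega> g"
proof (rule Bochner_Integration.integrable_bound[of _ "\<lambda>x. 1 + (g x)\<^sup>2"])
  interpret finite_measure \<omega> by (rule finite_measure_omega)
  show "integrable \<omega> (\<lambda>x. 1 + (g x)\<^sup>2)" using integrable_square by auto
  have "\<bar>t\<bar> \<le> 1 + t\<^sup>2" for t :: real
    using sum_squares_bound[of 1 "\<bar>t\<bar>"] by simp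
  then show "AE x in \<omega>. norm (g x) \<le> norm (1 + (g x)\<^sup>2)" by auto
qed measurable

definition cint_mass :: "nat \<Rightarrow> nat \<Rightarrow> real" where
  "cint_mass k j = (\<integral>x. indicator (cint N k j) x * g x \<partial>\<omega>)"

lemma integrable_cint_L2:
  "integrable \<omega> (\<lambda>x. indicator (cint N k j) x * g x)"
  using integrable_mult_indicator[OF _ integrable_L2, of "cint N k j"] by (simp add: sets_omega)

text \<open>The middle gap carries no mass, since almost every point lies in the Cantor set and
  hence in one of the children.\<close>

lemma cint_mass_add:
  assumes "j < 2 ^ k"
  shows "cint_mass k j = cint_mass (Suc k) (2 * j) + cint_mass (Suc k) (Suc (2 * j))"
proof -
  have "AE x in \<omega>. indicator (cint N k j) x * g x
      = indicator (cint N (Suc k) (2 * j)) x * g x + indicator (cint N (Suc k) (Suc (2 * j))) x * g x"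
    using AE_cantor_set
  proof eventually_elim
    case (elim x)
    show ?case
      using cantor_set_child[OF N elim assms] cint_sibling_disjoint[OF N, of k j]
        cint_Suc_subset[OF N, of k "2 * j"] cint_Suc_subset[OF N, of k "Suc (2 * j)"]
      by (auto simp: indicator_def simp del: cleft.simps)
  qed
  then have "cint_mass k j = (\<integral>x. indicator (cint N (Suc k) (2 * j)) x * g x
      + indicator (cint N (Suc k) (Suc (2 * j))) x * g x \<partial>\<omega>)"
    unfolding cint_mass_def by (intro integral_cong_AE) auto
  then show ?thesis
    unfolding cint_mass_def by (simp add: Bochner_Integration.integral_add integrable_cint_L2)
qed

text \<open>Since \<open>outer\<close> is linear in the masses, integrating its values for unit
  masses against \<open>g \<omega>\<close> gives its value for \<open>cint_mass\<close>.\<close>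

lemma outer_integral:
  "integrable \<omega> (\<lambda>x. outer N (\<lambda>k j. indicator (cint N k j) x) k j * g x)"
  "(\<integral>x. outer N (\<lambda>k j. indicator (cint N k j) x) k j * g x \<partial>\<omega>) = outer N cint_mass k j"
proof (induction k arbitrary: j)
  case (Suc k)
  have eq: "outer N (\<lambda>k j. indicator (cint N k j) x) (Suc k) j * g x
      = outer N (\<lambda>k j. indicator (cint N k j) x) k (j div 2) * g x
        + (if odd j then real N ^ k else - (real N ^ k))
          * (indicator (cint N (Suc k) (if odd j then j - 1 else Suc j)) x * g x)" for x j
    by (simp add: algebra_simps)
  {
    case 1
    show ?case unfolding eq
      by (intro Bochner_Integration.integrable_add integrable_mult_right Suc integrable_cint_L2)
  next
    case 2
    show ?case unfolding eq
      by (subst Bochner_Integration.integral_add) (use Suc integrable_cint_L2 in \<open>auto simp: cint_mass_def[symmetric]\<close>)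
  }
qed auto

lemma tree_op_integral:
  "integrable \<omega> (\<lambda>x. tree_op N (\<lambda>k j. indicator (cint N k j) x) k j * g x)"
  "(\<integral>x. tree_op N (\<lambda>k j. indicator (cint N k j) x) k j * g x \<partial>\<omega>) = tree_op N cint_mass k j"
proof -
  have eq: "tree_op N (\<lambda>k j. indicator (cint N k j) x) k j * g x
      = real N ^ k * (indicator (cint N (Suc k) (2 * j)) x * g x - indicator (cint N (Suc k) (Suc (2 * j))) x * g x)
        + outer N (\<lambda>k j. indicator (cint N k j) x) k j * g x" for x
    by (simp add: tree_op_def algebra_simps)
  note int = integrable_cint_L2 outer_integral(1)
  show "integrable \<omega> (\<lambda>x. tree_op N (\<lambda>k j. indicator (cint N k j) x) k j * g x)"
    unfolding eq using int by auto
  show "(\<integral>x. tree_op N (\<lambda>k j. indicator (cint N k j) x) k j * g x \<partial>\<omega>) = tree_op N cint_mass k j"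
    unfolding eq using int
    by (simp add: Bochner_Integration.integral_add Bochner_Integration.integral_diff outer_integral(2)
        tree_op_def cint_mass_def)
qed

lemma cint_mass_square_le:
  assumes "j < 2 ^ k"
  shows "(cint_mass k j)\<^sup>2 / omega_w N k j \<le> (\<integral>x. indicator (cint N k j) x * (g x)\<^sup>2 \<partial>\<omega>)"
proof -
  interpret finite_measure \<omega> by (rule finite_measure_omega)
  \<comment> \<open>The mean of \<open>g\<close> over the interval; expanding the integral of
    \<open>(g - c)\<^sup>2\<close> over it gives Cauchy-Schwarz.\<close>
  define c where "c = cint_mass k j / omega_w N k j"
  have w: "omega_w N k j > 0" by (rule omega_w_pos[OF N])
  have i1: "integrable \<omega> (\<lambda>x. indicator (cint N k j) x * (g x)\<^sup>2)"
    using integrable_mult_indicator[OF _ integrable_square, of "cint N k j"] by (simp add: sets_omega)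
  have i2: "integrable \<omega> (indicator (cint N k j) :: real \<Rightarrow> real)"
    by (rule integrable_real_indicator) (auto simp: less_top[symmetric])
  have eq: "indicator (cint N k j) x * (g x - c)\<^sup>2 = indicator (cint N k j) x * (g x)\<^sup>2
      - 2 * c * (indicator (cint N k j) x * g x) + c\<^sup>2 * indicator (cint N k j) x" for x
    by (simp add: power2_diff algebra_simps)
  have "0 \<le> (\<integral>x. indicator (cint N k j) x * (g x - c)\<^sup>2 \<partial>\<omega>)"
    by (intro integral_nonneg_AE) auto
  also have "\<dots> = (\<integral>x. indicator (cint N k j) x * (g x)\<^sup>2 \<partial>\<omega>) - 2 * c * cint_mass k j + c\<^sup>2 * omega_w N k j"
    unfolding eq using i1 i2 integrable_cint_L2 measure_cint[OF assms]
    by (simp add: cint_mass_def space_omega)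
  finally show ?thesis using w by (simp add: c_def power2_eq_square)
qed

lemma cint_mass_square_sum:
  "(\<Sum>j<2^k. (cint_mass k j)\<^sup>2 / omega_w N k j) \<le> (\<integral>x. (g x)\<^sup>2 \<partial>\<omega>)"
proof -
  have i: "integrable \<omega> (\<lambda>x. indicator (cint N k j) x * (g x)\<^sup>2)" for j
    using integrable_mult_indicator[OF _ integrable_square, of "cint N k j"] by (simp add: sets_omega)
  have "(\<Sum>j<2^k. (cint_mass k j)\<^sup>2 / omega_w N k j)
      \<le> (\<Sum>j<2^k. \<integral>x. indicator (cint N k j) x * (g x)\<^sup>2 \<partial>\<omega>)"
    by (intro sum_mono cint_mass_square_le) auto
  also have "\<dots> = (\<integral>x. (\<Sum>j<2^k. indicator (cint N k j) x * (g x)\<^sup>2) \<partial>\<omega>)"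
    by (rule Bochner_Integration.integral_sum[symmetric]) (rule i)
  also have "\<dots> \<le> (\<integral>x. (g x)\<^sup>2 \<partial>\<omega>)"
  proof (rule integral_mono)
    fix x
    have "disjoint_family_on (cint N k) {..<2^k}"
      using cint_disjoint[OF N] by (auto simp: disjoint_family_on_def)
    then have "(\<Sum>j<2^k. indicator (cint N k j) x) = (indicator (\<Union>j<2^k. cint N k j) x :: real)"
      by (intro indicator_UN_disjoint[symmetric]) auto
    then show "(\<Sum>j<2^k. indicator (cint N k j) x * (g x)\<^sup>2) \<le> (g x)\<^sup>2"
      by (simp add: sum_distrib_right[symmetric] indicator_def)
  qed (rule Bochner_Integration.integrable_sum i integrable_square)+
  finally show ?thesis .
qed

end

lemma kflat_integral:
  assumes "2/3 \<le> \<rho>" "\<rho> < 1" "admissible_base N \<rho> b"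
    and g: "g \<in> borel_measurable borel" "(\<integral>\<^sup>+ x. ennreal ((g x)\<^sup>2) \<partial>\<omega>) < \<infinity>"
    and y: "j < 2 ^ k" "y \<in> Lint N k j"
  shows "integrable \<omega> (\<lambda>x. kflat N b (y - x) * g x)"
    and "(\<integral>x. kflat N b (y - x) * g x \<partial>\<omega>) = tree_op N (cint_mass g) k j"
proof -
  have [measurable]: "kflat N b \<in> borel_measurable borel"
    using kflat_borel_measurable[OF N assms(1-3)] .
  note [measurable] = g(1)
  note T = tree_op_integral[OF g, of k j]
  have ae: "AE x in \<omega>. kflat N b (y - x) * g x = tree_op N (\<lambda>k j. indicator (cint N k j) x) k j * g x"
    using AE_cantor_set by eventually_elim (simp add: kflat_eq_tree_op[OF N assms(1-3) _ y])
  have m: "(\<lambda>x. tree_op N (\<lambda>k j. indicator (cint N k j) x) k j * g x) \<in> borel_measurable \<omega>"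
    using T(1) by auto
  show "integrable \<omega> (\<lambda>x. kflat N b (y - x) * g x)"
    using T(1) by (subst integrable_cong_AE[OF _ m ae]) measurable
  show "(\<integral>x. kflat N b (y - x) * g x \<partial>\<omega>) = tree_op N (cint_mass g) k j"
    using T(2) by (subst integral_cong_AE[OF _ m ae]) measurable
qed

lemma kflat_bounded:
  assumes "2/3 \<le> \<rho>" "\<rho> < 1" "admissible_base N \<rho> b"
    and g: "g \<in> borel_measurable borel" "(\<integral>\<^sup>+ x. ennreal ((g x)\<^sup>2) \<partial>\<omega>) < \<infinity>"
  shows "(\<integral>\<^sup>+ y. ennreal ((\<integral>x. kflat N b (y - x) * g x \<partial>\<omega>)\<^sup>2) \<partial>sigma_hat N)
    \<le> ennreal 3 * (\<integral>\<^sup>+ x. ennreal ((g x)\<^sup>2) \<partial>\<omega>)"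
proof -
  interpret finite_measure \<omega> by (rule finite_measure_omega)
  have [measurable]: "kflat N b \<in> borel_measurable borel"
    using kflat_borel_measurable[OF N assms(1-3)] .
  note [measurable] = g(1)
  note KI = kflat_integral[OF assms(1-3) g]
  define T where "T = tree_op N (cint_mass g)"
  have [measurable]: "(\<lambda>y. \<integral>x. kflat N b (y - x) * g x \<partial>\<omega>) \<in> borel_measurable borel"
    by (rule borel_measurable_lebesgue_integral) measurable
  \<comment> \<open>The integrand is constant on \<open>Lint N k j\<close>, whose length cancels
    against the density; the definition of \<open>s_hat\<close> turns the rest into a summand of
    \<open>tree_op_square_sum\<close>.\<close>
  have term_eq: "ennreal (s_hat N k j / (2 * (1 / real N) ^ Suc k)) *
      (\<integral>\<^sup>+ y\<in>Lint N k j. ennreal ((\<integral>x. kflat N b (y - x) * g x \<partial>\<omega>)\<^sup>2) \<partial>lborel)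
      = ennreal ((T k j / real N ^ k)\<^sup>2 / omega_w N k j)" if j: "j < 2 ^ k" for k j
  proof -
    have w: "omega_w N k j > 0" by (rule omega_w_pos[OF N])
    have h: "(1 / real N) ^ Suc k > 0" by (rule scale_pos[OF N])
    have "(\<integral>\<^sup>+ y\<in>Lint N k j. ennreal ((\<integral>x. kflat N b (y - x) * g x \<partial>\<omega>)\<^sup>2) \<partial>lborel)
        = (\<integral>\<^sup>+ y\<in>Lint N k j. ennreal ((T k j)\<^sup>2) \<partial>lborel)"
      by (intro nn_integral_cong) (auto simp: indicator_def KI(2)[OF j] T_def)
    also have "\<dots> = ennreal ((T k j)\<^sup>2) * ennreal (2 * (1 / real N) ^ Suc k)"
      using emeasure_Lint[OF N] by (subst nn_integral_cmult_indicator) (auto simp: Lint_def)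
    finally show ?thesis using w h N
      by (simp add: ennreal_mult[symmetric] s_hat_def power_divide power_mult power2_eq_square
          power_mult_distrib field_simps del: power_Suc)
  qed
  have "(\<integral>\<^sup>+ y. ennreal ((\<integral>x. kflat N b (y - x) * g x \<partial>\<omega>)\<^sup>2) \<partial>sigma_hat N)
      = (\<Sum>k. \<Sum>j<2^k. ennreal ((T k j / real N ^ k)\<^sup>2 / omega_w N k j))"
    by (subst nn_integral_sigma_hat) (auto intro!: suminf_cong sum.cong simp: term_eq simp del: power_Suc)
  also have "\<dots> = (SUP n. \<Sum>k<n. \<Sum>j<2^k. ennreal ((T k j / real N ^ k)\<^sup>2 / omega_w N k j))"
    by (rule suminf_eq_SUP)
  also have "\<dots> \<le> ennreal (3 * (\<integral>x. (g x)\<^sup>2 \<partial>\<omega>))"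
  proof (rule SUP_least)
    fix n
    have "(\<Sum>k<n. \<Sum>j<2^k. ennreal ((T k j / real N ^ k)\<^sup>2 / omega_w N k j))
        = ennreal (\<Sum>k<n. \<Sum>j<2^k. (T k j / real N ^ k)\<^sup>2 / omega_w N k j)"
      using omega_w_pos[OF N] by (simp add: sum_nonneg less_imp_le sum_ennreal)
    also have "(\<Sum>k<n. \<Sum>j<2^k. (T k j / real N ^ k)\<^sup>2 / omega_w N k j)
        \<le> 3 * (\<Sum>j<2^n. (cint_mass g n j)\<^sup>2 / omega_w N n j)"
      unfolding T_def by (rule tree_op_square_sum[OF N, of "cint_mass g", OF cint_mass_add[OF g]])
    also have "\<dots> \<le> 3 * (\<integral>x. (g x)\<^sup>2 \<partial>\<omega>)" using cint_mass_square_sum[OF g] by simp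
    finally show "(\<Sum>k<n. \<Sum>j<2^k. ennreal ((T k j / real N ^ k)\<^sup>2 / omega_w N k j))
        \<le> ennreal (3 * (\<integral>x. (g x)\<^sup>2 \<partial>\<omega>))" by (simp add: ennreal_leI)
  qed
  also have "\<dots> = ennreal 3 * ennreal (\<integral>x. (g x)\<^sup>2 \<partial>\<omega>)" by (rule ennreal_mult) auto
  also have "ennreal (\<integral>x. (g x)\<^sup>2 \<partial>\<omega>) = (\<integral>\<^sup>+ x. ennreal ((g x)\<^sup>2) \<partial>\<omega>)"
    by (rule nn_integral_eq_integral[symmetric]) (use integrable_square[OF g] in auto)
  finally show ?thesis .
qed

end

subsection \<open>Failure of the backward energy condition\<close>

text \<open>The points of \<open>I0\<close> outside \<open>F\<close> are classified by which members
  of \<open>F\<close> lie to their left. Each class \<open>C A\<close> is an interval, and there are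
  finitely many of them.\<close>

lemma interval_decomp_extend:
  fixes I0 :: "real set"
  assumes F: "finite F" "\<And>L. L \<in> F \<Longrightarrow> is_interval L \<and> L \<noteq> {} \<and> L \<subseteq> I0" "disjoint F" and I0: "is_interval I0"
  obtains I :: "nat \<Rightarrow> real set" where "\<forall>r. is_interval (I r)" "disjoint_family I" "(\<Union>r. I r) = I0" "F \<subseteq> range I"
proof -
  define C where "C A = {x \<in> I0. x \<notin> \<Union>F \<and> {L \<in> F. \<forall>y\<in>L. y < x} = A}" for A
  define P where "P = F \<union> C ` Pow F - {{}}"
  have C_int: "is_interval (C A)" for A
    unfolding is_interval_1
  proof (intro ballI allI impI)
    fix a b x assume a: "a \<in> C A" and b: "b \<in> C A" and x: "a \<le> x \<and> x \<le> b"
    have "x \<in> I0" using a b x I0 unfolding C_def is_interval_1 by blast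
    \<comment> \<open>If \<open>x\<close> were in \<open>L\<close>, then \<open>L\<close> would lie
      to the left of \<open>b\<close> but not of \<open>a\<close>, although \<open>a\<close> and
      \<open>b\<close> belong to the same class.\<close>
    have "x \<notin> L" if L: "L \<in> F" for L
    proof
      assume "x \<in> L"
      have "b \<notin> L" using b L unfolding C_def by auto
      have "y < b" if "y \<in> L" for y
      proof (rule ccontr)
        assume "\<not> y < b"
        then have "b \<in> L" using F(2)[OF L] \<open>x \<in> L\<close> that x unfolding is_interval_1 by (meson not_less)
        then show False using \<open>b \<notin> L\<close> by simp
      qed
      then have "L \<in> A" using b L unfolding C_def by auto
      then have "L \<in> {L \<in> F. \<forall>y\<in>L. y < a}" using a unfolding C_def by blast
      then show False using x \<open>x \<in> L\<close> by auto
    qed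
    moreover have "{L \<in> F. \<forall>y\<in>L. y < x} = A"
    proof -
      have "{L \<in> F. \<forall>y\<in>L. y < a} = A" "{L \<in> F. \<forall>y\<in>L. y < b} = A"
        using a b unfolding C_def by simp_all
      moreover have "{L \<in> F. \<forall>y\<in>L. y < a} \<subseteq> {L \<in> F. \<forall>y\<in>L. y < x}"
        "{L \<in> F. \<forall>y\<in>L. y < x} \<subseteq> {L \<in> F. \<forall>y\<in>L. y < b}"
        using x by auto
      ultimately show ?thesis by simp
    qed
    ultimately show "x \<in> C A" using \<open>x \<in> I0\<close> unfolding C_def by auto
  qed
  have P_int: "is_interval X" if "X \<in> P" for X using that F(2) C_int unfolding P_def by auto
  have "finite P" using F(1) unfolding P_def by auto
  have P_un: "\<Union>P = I0"
  proof
    show "\<Union>P \<subseteq> I0" using F(2) unfolding P_def C_def by auto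
    show "I0 \<subseteq> \<Union>P"
    proof
      fix x assume x: "x \<in> I0"
      show "x \<in> \<Union>P"
      proof (cases "x \<in> \<Union>F")
        case True
        then show ?thesis using F(2) unfolding P_def by auto
      next
        case False
        let ?A = "{L \<in> F. \<forall>y\<in>L. y < x}"
        have "x \<in> C ?A" using x False unfolding C_def by auto
        then have "C ?A \<in> P" unfolding P_def by auto
        then show ?thesis using \<open>x \<in> C ?A\<close> by blast
      qed
    qed
  qed
  have P_disj: "X \<inter> Y = {}" if "X \<in> P" "Y \<in> P" "X \<noteq> Y" for X Y
  proof -
    have 1: "L \<inter> C A = {}" if "L \<in> F" for L A using that unfolding C_def by auto
    have 2: "C A \<inter> C B = {}" if "A \<noteq> B" for A B using that unfolding C_def by auto
    have 3: "L \<inter> M = {}" if "L \<in> F" "M \<in> F" "L \<noteq> M" for L M using F(3) that by (auto simp: disjoint_def)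
    show ?thesis using that 1 2 3 unfolding P_def by (elim UnE DiffE imageE) (metis Int_commute)+
  qed
  obtain f where f: "bij_betw f {0..<card P} P" using ex_bij_betw_nat_finite[OF \<open>finite P\<close>] by blast
  \<comment> \<open>The pieces are finitely many; the empty interval fills the remaining
    indices.\<close>
  define I where "I r = (if r < card P then f r else {})" for r
  have fP: "f r \<in> P" if "r < card P" for r using f that unfolding bij_betw_def by auto
  show ?thesis
  proof
    show "\<forall>r. is_interval (I r)" using P_int[OF fP] unfolding I_def by auto
    show "disjoint_family I" unfolding disjoint_family_on_def
    proof (intro ballI impI)
      fix r s :: nat assume "r \<noteq> s"
      show "I r \<inter> I s = {}"
      proof (cases "r < card P \<and> s < card P")
        case True
        then have "f r \<noteq> f s" using f \<open>r \<noteq> s\<close> unfolding bij_betw_def inj_on_def by auto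
        then show ?thesis using P_disj[of "f r" "f s"] fP True unfolding I_def by auto
      qed (auto simp: I_def)
    qed
    have img: "f ` {0..<card P} = P" using f by (simp add: bij_betw_def)
    have "(\<Union>r. I r) = \<Union>(f ` {0..<card P})" unfolding I_def by (auto split: if_splits)
    then show "(\<Union>r. I r) = I0" using img P_un by simp
    show "F \<subseteq> range I"
    proof
      fix L assume "L \<in> F"
      then have "L \<in> P" using F(2) unfolding P_def by auto
      then obtain r where "r < card P" "f r = L" using img by (metis imageE atLeastLessThan_iff)
      then show "L \<in> range I" unfolding I_def by (auto intro!: image_eqI[of _ _ r])
    qed
  qed
qed

lemma sum_le_suminf_range:
  fixes T :: "'a set \<Rightarrow> ennreal"
  assumes "finite F" "F \<subseteq> range I" 
  shows "(\<Sum>L\<in>F. T L) \<le> (\<Sum>r. T (I r))"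
proof -
  obtain h where h: "\<And>L. L \<in> F \<Longrightarrow> I (h L) = L" using assms(2) by (metis f_inv_into_f subsetD)
  then have "inj_on h F" by (metis inj_onI)
  then have "(\<Sum>L\<in>F. T L) = (\<Sum>r\<in>h ` F. T (I r))" by (subst sum.reindex) (auto simp: h)
  also have "\<dots> \<le> (\<Sum>r. T (I r))" using assms(1) by (intro sum_le_suminf) auto
  finally show ?thesis .
qed

lemma omega_w_sum: "(\<Sum>j<2^k. omega_w N k j) = 1"
proof (induction k)
  case (Suc k)
  have "(\<Sum>j<2 ^ Suc k. omega_w N (Suc k) j) = (\<Sum>j<2^k. omega_w N k j)"
    unfolding power_Suc sum_pairs omega_w_children by (intro sum.cong) (auto simp: field_simps)
  then show ?case using Suc by simp
qed simp

section \<open>Lower bounds for the backward energy terms\<close>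

context
  fixes N :: nat
  assumes N: "N \<ge> 16"
begin

lemma cint_ancestor: "cint N (k + m) j \<subseteq> cint N k (j div 2 ^ m)"
proof (induction m arbitrary: j)
  case (Suc m)
  have "cint N (k + Suc m) j \<subseteq> cint N (k + m) (j div 2)" using cint_Suc_subset[OF N] by simp
  also have "\<dots> \<subseteq> cint N k (j div 2 div 2 ^ m)" by (rule Suc)
  finally show ?case by (simp add: div_mult2_eq)
qed simp

lemma cint_subset_unit: "cint N k j \<subseteq> {0..1}"
  using cint_ancestor[of 0 k j] by (simp add: cint_def)

text \<open>In different generations, the later interval lies inside a Cantor interval of generation
  \<open>Suc k\<close>, which the middle piece of the earlier one avoids.\<close>

lemma Lint_disjoint:
  assumes "j < 2 ^ k" "j' < 2 ^ k'" "(k, j) \<noteq> (k', j')"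
  shows "Lint N k j \<inter> Lint N k' j' = {}"
proof -
  have less: "Lint N k j \<inter> Lint N k' j' = {}" if "k < k'" "j < 2 ^ k" "j' < 2 ^ k'" for k k' j j'
  proof -
    obtain m where k': "k' = Suc k + m" using \<open>k < k'\<close> less_iff_Suc_add by auto
    define i where "i = j' div 2 ^ m"
    have "j' < 2 ^ Suc k * 2 ^ m" using that unfolding k' by (simp add: power_add)
    then have i: "i < 2 ^ Suc k" unfolding i_def by (simp add: div_less_iff_less_mult)
    have sub: "Lint N k' j' \<subseteq> cint N (Suc k) i"
      using Lint_subset_cint[OF N, of k' j'] cint_ancestor[of "Suc k" m j'] unfolding k' i_def by blast
    show ?thesis
    proof (cases "i div 2 = j")
      case True
      then have "i = 2 * j \<or> i = Suc (2 * j)" by linarith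
      then show ?thesis using sub Lint_disjoint_children[OF N, of k j] by blast
    next
      case False
      have "i div 2 < 2 ^ k" using i by auto
      then have "cint N k (i div 2) \<inter> cint N k j = {}" using cint_disjoint[OF N] False that by blast
      then show ?thesis using sub cint_Suc_subset[OF N, of k i] Lint_subset_cint[OF N, of k j] by blast
    qed
  qed
  consider "k < k'" | "k' < k" | "k = k'" "j \<noteq> j'" using assms(3) by fastforce
  then show ?thesis
  proof cases
    case 3
    then show ?thesis
      using cint_disjoint[OF N, of j k j'] assms Lint_subset_cint[OF N, of k] by blast
  qed (use less assms in blast)+
qed

lemma Lint_measurable [measurable]: "Lint N k j \<in> sets borel"
  by (simp add: Lint_def)

lemma measure_Lint: "measure lborel (Lint N k j) = 2 * (1 / real N) ^ Suc k"
  using emeasure_Lint[OF N, of k j] scale_pos[OF N, of "Suc k"] by (simp add: measure_def del: power_Suc)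

lemma sets_sigma_hat [measurable_cong]: "sets (sigma_hat N) = sets borel"
  by (simp add: sigma_hat_def)

lemma s_hat_pos: "s_hat N k j > 0"
  using N omega_w_pos[OF N] by (simp add: s_hat_def)

text \<open>By disjointness only one summand of the density is nonzero on \<open>A\<close>.\<close>

lemma emeasure_sigma_hat_subset:
  assumes [measurable]: "A \<in> sets borel" and A: "A \<subseteq> Lint N k j" and j: "j < 2 ^ k"
  shows "emeasure (sigma_hat N) A = ennreal (s_hat N k j / (2 * (1 / real N) ^ Suc k)) * emeasure lborel A"
proof -
  let ?c = "\<lambda>k j. ennreal (s_hat N k j / (2 * (1 / real N) ^ Suc k))"
  have int: "(\<integral>\<^sup>+ y\<in>Lint N k' j'. indicator A y \<partial>lborel) = (if (k', j') = (k, j) then emeasure lborel A else 0)"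
    if "j' < 2 ^ k'" for k' j'
  proof -
    have "indicator A y * indicator (Lint N k' j') y = (if (k', j') = (k, j) then indicator A y else 0 :: ennreal)" for y
      using A Lint_disjoint[OF that j] by (auto simp: indicator_def split: if_splits)
    then have "(\<integral>\<^sup>+ y\<in>Lint N k' j'. indicator A y \<partial>lborel)
        = (\<integral>\<^sup>+ y. (if (k', j') = (k, j) then indicator A y else 0) \<partial>lborel)"
      by (intro nn_integral_cong)
    also have "\<dots> = (if (k', j') = (k, j) then emeasure lborel A else 0)"
      by (cases "k' = k \<and> j' = j") auto
    finally show ?thesis .
  qed
  have "emeasure (sigma_hat N) A = (\<integral>\<^sup>+ y. indicator A y \<partial>sigma_hat N)"
    by (rule nn_integral_indicator[symmetric]) measurable
  also have "\<dots> = (\<Sum>k'. \<Sum>j'<2^k'. ?c k' j' * (\<integral>\<^sup>+ y\<in>Lint N k' j'. indicator A y \<partial>lborel))"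
    by (rule nn_integral_sigma_hat) measurable
  also have "\<dots> = (\<Sum>k'. \<Sum>j'<2^k'. if (k', j') = (k, j) then ?c k j * emeasure lborel A else 0)"
    by (intro suminf_cong sum.cong) (auto simp: int simp del: power_Suc)
  also have "\<dots> = (\<Sum>k'. if k' = k then ?c k j * emeasure lborel A else 0)"
  proof (intro suminf_cong)
    fix k' show "(\<Sum>j'<2^k'. if (k', j') = (k, j) then ?c k j * emeasure lborel A else 0)
        = (if k' = k then ?c k j * emeasure lborel A else 0)"
      using j by (cases "k' = k") (auto simp del: power_Suc)
  qed
  also have "\<dots> = ?c k j * emeasure lborel A"
    by (subst suminf_finite[of "{k}"]) auto
  finally show ?thesis .
qed

lemma emeasure_sigma_hat_Icc:
  assumes "{u..v} \<subseteq> Lint N k j" "j < 2 ^ k" "0 \<le> t" "v - u = t * (2 * (1 / real N) ^ Suc k)"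
  shows "emeasure (sigma_hat N) {u..v} = ennreal (s_hat N k j * t)"
proof -
  let ?l = "2 * (1 / real N) ^ Suc k"
  have l: "?l > 0" using scale_pos[OF N, of "Suc k"] by simp
  have uv: "u \<le> v" using assms(3,4) l by (smt (verit) mult_nonneg_nonneg)
  have "emeasure (sigma_hat N) {u..v} = ennreal (s_hat N k j / ?l) * ennreal (t * ?l)"
    using emeasure_sigma_hat_subset[OF _ assms(1,2)] emeasure_lborel_Icc[OF uv] assms(4) by simp
  also have "\<dots> = ennreal (s_hat N k j / ?l * (t * ?l))"
    using l s_hat_pos[of k j] assms(3) by (intro ennreal_mult[symmetric]) auto
  also have "s_hat N k j / ?l * (t * ?l) = s_hat N k j * t" using l N by (simp del: power_Suc)
  finally show ?thesis .
qed

lemma emeasure_sigma_hat_Lint: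
  assumes "j < 2 ^ k"
  shows "emeasure (sigma_hat N) (Lint N k j) = ennreal (s_hat N k j)"
  using emeasure_sigma_hat_Icc[of "ccenter N k j - (1 / real N) ^ Suc k" "ccenter N k j + (1 / real N) ^ Suc k" k j 1] assms
  unfolding Lint_def by (simp del: power_Suc)

text \<open>The outer quarters \<open>A\<close> and \<open>B\<close> have mass \<open>s/4\<close>
  each and are at least half the length apart, so the double integral is at least
  \<open>(1/4) * (s/4)\<^sup>2\<close>, to be divided by \<open>2 * s\<^sup>2\<close>.\<close>

lemma energy_sq_Lint:
  assumes j: "j < 2 ^ k"
  shows "ennreal (1 / 128) \<le> energy_sq (Lint N k j) (sigma_hat N)"
proof -
  let ?L = "Lint N k j" and ?\<sigma> = "sigma_hat N"
  define l where "l = (1 / real N) ^ Suc k"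
  define c where "c = ccenter N k j"
  define s where "s = s_hat N k j"
  have l: "l > 0" unfolding l_def using scale_pos[OF N] .
  have s: "s > 0" unfolding s_def using s_hat_pos .
  have L: "?L = {c - l..c + l}" unfolding Lint_def c_def l_def ..
  define A where "A = {c - l..c - l / 2}"
  define B where "B = {c + l / 2..c + l}"
  have AB: "A \<subseteq> ?L" "B \<subseteq> ?L" unfolding A_def B_def L using l by auto
  have [measurable]: "A \<in> sets borel" "B \<in> sets borel" unfolding A_def B_def by auto
  have mA: "emeasure ?\<sigma> A = ennreal (s / 4)" "emeasure ?\<sigma> B = ennreal (s / 4)"
    unfolding A_def B_def s_def
    using emeasure_sigma_hat_Icc[OF AB(1)[unfolded A_def] j, of "1/4"]
      emeasure_sigma_hat_Icc[OF AB(2)[unfolded B_def] j, of "1/4"]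
    by (simp_all add: l_def[symmetric] del: power_Suc)
  have ml: "measure lborel ?L = 2 * l" using measure_Lint[of k j] by (simp add: l_def)
  have inner: "ennreal (s / 16) \<le> (\<integral>\<^sup>+ x'\<in>?L. ennreal ((x - x')\<^sup>2 / (measure lborel ?L)\<^sup>2) \<partial>?\<sigma>)" if x: "x \<in> A" for x
  proof -
    have "ennreal (s / 16) = ennreal (1/4) * ennreal (s / 4)" using s by (simp flip: ennreal_mult)
    also have "\<dots> = (\<integral>\<^sup>+ x'. ennreal (1/4) * indicator B x' \<partial>?\<sigma>)"
      unfolding mA(2)[symmetric] by (rule nn_integral_cmult_indicator[symmetric]) measurable
    also have "\<dots> \<le> (\<integral>\<^sup>+ x'\<in>?L. ennreal ((x - x')\<^sup>2 / (measure lborel ?L)\<^sup>2) \<partial>?\<sigma>)"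
    proof (rule nn_integral_mono)
      fix x'
      have "1 / 4 \<le> (x - x')\<^sup>2 / (2 * l)\<^sup>2" if "x' \<in> B"
      proof -
        have "l \<le> x' - x" using x that unfolding A_def B_def by auto
        then have "l\<^sup>2 \<le> (x' - x)\<^sup>2" using l by (intro power_mono) auto
        then show ?thesis using l by (simp add: power2_commute field_simps)
      qed
      then show "ennreal (1/4) * indicator B x' \<le> ennreal ((x - x')\<^sup>2 / (measure lborel ?L)\<^sup>2) * indicator ?L x'"
        using AB unfolding ml by (auto simp: indicator_def intro!: ennreal_leI)
    qed
    finally show ?thesis .
  qed
  have "ennreal (s / 16) * ennreal (s / 4) = (\<integral>\<^sup>+ x. ennreal (s / 16) * indicator A x \<partial>?\<sigma>)"
    unfolding mA(1)[symmetric] by (rule nn_integral_cmult_indicator[symmetric]) measurable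
  also have "\<dots> \<le> (\<integral>\<^sup>+ x\<in>?L. (\<integral>\<^sup>+ x'\<in>?L. ennreal ((x - x')\<^sup>2 / (measure lborel ?L)\<^sup>2) \<partial>?\<sigma>) \<partial>?\<sigma>)"
    using AB inner by (intro nn_integral_mono) (auto simp: indicator_def)
  finally have "ennreal (s\<^sup>2 / 64) \<le> (\<integral>\<^sup>+ x\<in>?L. (\<integral>\<^sup>+ x'\<in>?L. ennreal ((x - x')\<^sup>2 / (measure lborel ?L)\<^sup>2) \<partial>?\<sigma>) \<partial>?\<sigma>)"
    using s by (simp add: power2_eq_square flip: ennreal_mult)
  then have "ennreal (s\<^sup>2 / 64) / (2 * (emeasure ?\<sigma> ?L)\<^sup>2) \<le> energy_sq ?L ?\<sigma>"
    unfolding energy_sq_def by (rule divide_right_mono_ennreal)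
  moreover have "2 * (emeasure ?\<sigma> ?L)\<^sup>2 = ennreal (2 * s\<^sup>2)"
    using s emeasure_sigma_hat_Lint[OF j] by (simp add: s_def ennreal_mult ennreal_power)
  moreover have "ennreal (s\<^sup>2 / 64) / ennreal (2 * s\<^sup>2) = ennreal (1 / 128)"
    using s by (subst divide_ennreal) auto
  ultimately show ?thesis by simp
qed

text \<open>Only the mass of \<open>cint N k j\<close> is kept. For \<open>x\<close> there, length
  plus distance is at most \<open>h/2 + h/2\<close>, so the integrand is at least
  \<open>(2 * h / N) / h\<^sup>2\<close>.\<close>

lemma poisson_Lint:
  assumes \<omega>: "redistributed_cantor N \<omega>" and j: "j < 2 ^ k"
  shows "ennreal (2 * real N ^ k / N * omega_w N k j) \<le> poisson (Lint N k j) (density \<omega> (indicator {0..1}))"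
proof -
  have bm: "borel_measurable \<omega> = borel_measurable borel"
    by (rule measurable_cong_sets[OF sets_omega[OF N \<omega>] refl])
  let ?L = "Lint N k j"
  define h where "h = (1 / real N) ^ k"
  have h: "h > 0" unfolding h_def using scale_pos[OF N] .
  have ml: "measure lborel ?L = 2 * h / N" using measure_Lint[of k j] by (simp add: h_def)
  have c: "ccenter N k j \<in> ?L" using scale_pos[OF N, of "Suc k"] unfolding Lint_def by auto
  have [measurable]: "(\<lambda>x. infdist x ?L) \<in> borel_measurable borel"
    by (intro borel_measurable_continuous_onI continuous_intros)
  have ml0: "measure lborel ?L > 0" unfolding ml using h N by auto
  have "ennreal (2 * real N ^ k / N * omega_w N k j) = ennreal (2 * real N ^ k / N) * emeasure \<omega> (cint N k j)"
    using emeasure_cint[OF N \<omega> j] omega_w_pos[OF N, of k j]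
      ennreal_mult[of "2 * real N ^ k / N" "omega_w N k j"] by simp
  also have "\<dots> = (\<integral>\<^sup>+ x. ennreal (2 * real N ^ k / N) * indicator (cint N k j) x \<partial>\<omega>)"
    by (rule nn_integral_cmult_indicator[symmetric]) (simp add: sets_omega[OF N \<omega>] cint_def)
  also have "\<dots> \<le> (\<integral>\<^sup>+ x. indicator {0..1} x * ennreal (measure lborel ?L / (measure lborel ?L + infdist x ?L)\<^sup>2) \<partial>\<omega>)"
  proof (rule nn_integral_mono)
    fix x
    have "2 * real N ^ k / N \<le> measure lborel ?L / (measure lborel ?L + infdist x ?L)\<^sup>2" if "x \<in> cint N k j"
    proof -
      have "infdist x ?L \<le> dist x (ccenter N k j)" by (rule infdist_le[OF c])
      also have "\<dots> \<le> h / 2" using that unfolding cint_def ccenter_def dist_real_def h_def[symmetric]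
        by (auto simp: abs_le_iff field_simps)
      finally have "infdist x ?L \<le> h / 2" .
      moreover have "measure lborel ?L \<le> h / 2" unfolding ml using N h by (simp add: field_simps)
      ultimately have "(measure lborel ?L + infdist x ?L)\<^sup>2 \<le> h\<^sup>2"
        using ml0 infdist_nonneg[of x ?L] by (intro power_mono) auto
      then have "measure lborel ?L / h\<^sup>2 \<le> measure lborel ?L / (measure lborel ?L + infdist x ?L)\<^sup>2"
        using ml0 infdist_nonneg[of x ?L] h by (intro divide_left_mono mult_pos_pos zero_less_power add_pos_nonneg) auto
      moreover have "measure lborel ?L / h\<^sup>2 = 2 * real N ^ k / N"
        using N unfolding ml h_def by (simp add: power2_eq_square field_simps)
      ultimately show ?thesis by simp
    qed
    then show "ennreal (2 * real N ^ k / N) * indicator (cint N k j) x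
        \<le> indicator {0..1} x * ennreal (measure lborel ?L / (measure lborel ?L + infdist x ?L)\<^sup>2)"
      using cint_subset_unit[of k j] by (auto simp: indicator_def intro!: ennreal_leI)
  qed
  also have "\<dots> = poisson ?L (density \<omega> (indicator {0..1}))"
    unfolding poisson_def by (subst nn_integral_density; (unfold bm, measurable)?) (rule refl)
  finally show ?thesis .
qed

text \<open>The definition of \<open>s_hat\<close> makes
  \<open>s_hat * (N^k * omega_w)\<^sup>2\<close> equal to \<open>omega_w\<close>; the constants give
  \<open>4/128 = 1/32\<close>.\<close>

lemma backward_term_Lint:
  assumes \<omega>: "redistributed_cantor N \<omega>" and j: "j < 2 ^ k"
  shows "ennreal (omega_w N k j / (32 * N\<^sup>2)) \<le> backward_term (sigma_hat N) \<omega> {0..1} (Lint N k j)"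
proof -
  let ?w = "omega_w N k j" and ?s = "s_hat N k j"
  have w: "?w > 0" by (rule omega_w_pos[OF N])
  have w_eq: "?w / (32 * N\<^sup>2) = ?s * (1 / 128) * (2 * real N ^ k / N * ?w)\<^sup>2"
    using w N unfolding s_hat_def
    by (simp add: power_divide power_mult_distrib power_mult field_simps) (simp add: power2_eq_square)
  have mult_eq: "ennreal (s * (1 / 128) * p\<^sup>2) = ennreal s * ennreal (1 / 128) * (ennreal p)\<^sup>2"
    if "s \<ge> 0" "p \<ge> 0" for s p
    using that by (simp only: ennreal_mult ennreal_power zero_le_power mult_nonneg_nonneg zero_le_divide_1_iff zero_le_numeral)
  have "ennreal (?w / (32 * N\<^sup>2)) = ennreal ?s * ennreal (1 / 128) * (ennreal (2 * real N ^ k / N * ?w))\<^sup>2"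
    unfolding w_eq by (rule mult_eq) (use w s_hat_pos[of k j] in auto)
  also have "\<dots> \<le> emeasure (sigma_hat N) (Lint N k j) * energy_sq (Lint N k j) (sigma_hat N)
      * (poisson (Lint N k j) (density \<omega> (indicator {0..1})))\<^sup>2"
    using emeasure_sigma_hat_Lint[OF j] energy_sq_Lint[OF j] poisson_Lint[OF \<omega> j]
    by (intro mult_mono power_mono) auto
  also have "\<dots> = backward_term (sigma_hat N) \<omega> {0..1} (Lint N k j)"
    using emeasure_sigma_hat_Lint[OF j] s_hat_pos[of k j] by (simp add: backward_term_def)
  finally show ?thesis .
qed

text \<open>The masses in one generation sum to \<open>1\<close>, so the intervals
  \<open>Lint\<close> of the first \<open>n\<close> generations contribute at least
  \<open>n / (32 * N\<^sup>2)\<close>. Finite families suffice, since the supremum runs over all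
  decompositions and \<open>n\<close> is arbitrary.\<close>

lemma backward_energy_unbounded:
  assumes \<omega>: "redistributed_cantor N \<omega>"
  shows "(SUP (I0, I) \<in> interval_decomps \<omega>.
    (\<Sum>r. backward_term (sigma_hat N) \<omega> I0 (I r)) / emeasure \<omega> I0) = \<infinity>" (is "?S = \<infinity>")
proof -
  let ?T = "backward_term (sigma_hat N) \<omega> {0..1}"
  have "cint N 0 0 = {0..1}" by (simp add: cint_def)
  then have one: "emeasure \<omega> {0..1} = 1" using emeasure_cint[OF N \<omega>, of 0 0] by simp
  have lower: "ennreal (real n / (32 * N\<^sup>2)) \<le> ?S" for n
  proof -
    define J where "J = (SIGMA k:{..<n}. {..<2 ^ k :: nat})"
    have inj: "inj_on (\<lambda>(k, j). Lint N k j) J"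
    proof (rule inj_onI, clarify)
      fix k j k' j' assume J: "(k, j) \<in> J" "(k', j') \<in> J" "Lint N k j = Lint N k' j'"
      have "ccenter N k j \<in> Lint N k j" using scale_pos[OF N, of "Suc k"] unfolding Lint_def by auto
      then show "k = k' \<and> j = j'" using Lint_disjoint[of j k j' k'] J unfolding J_def by auto
    qed
    define F where "F = (\<lambda>(k, j). Lint N k j) ` J"
    have fin: "finite F" unfolding F_def J_def by auto
    have F_sub: "is_interval L \<and> L \<noteq> {} \<and> L \<subseteq> {0..1}" if LF: "L \<in> F" for L
    proof -
      obtain k j where L: "L = Lint N k j" using LF unfolding F_def by auto
      have "ccenter N k j \<in> L" using scale_pos[OF N, of "Suc k"] unfolding L Lint_def by auto
      moreover have "is_interval L" unfolding L Lint_def by (rule is_interval_cc)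
      ultimately show ?thesis using Lint_subset_cint[OF N, of k j] cint_subset_unit[of k j] L by blast
    qed
    have F_disj: "disjoint F" 
    proof (rule disjointI)
      fix L M assume LM: "L \<in> F" "M \<in> F" "L \<noteq> M"
      from LM(1) obtain k j where L: "L = Lint N k j" "j < 2 ^ k" unfolding F_def J_def by auto
      from LM(2) obtain k' j' where M: "M = Lint N k' j'" "j' < 2 ^ k'" unfolding F_def J_def by auto
      show "L \<inter> M = {}" unfolding L M using LM(3) L M by (intro Lint_disjoint) auto
    qed
    obtain I :: "nat \<Rightarrow> real set"
      where I: "\<forall>r. is_interval (I r)" "disjoint_family I" "(\<Union>r. I r) = {0..1::real}" "F \<subseteq> range I"
      by (rule interval_decomp_extend[OF fin F_sub F_disj is_interval_cc])
    have "real n / (32 * N\<^sup>2) = (\<Sum>k<n. \<Sum>j<2^k. omega_w N k j / (32 * N\<^sup>2))"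
      by (simp add: omega_w_sum flip: sum_divide_distrib)
    also have "\<dots> = (\<Sum>(k, j)\<in>J. omega_w N k j / (32 * N\<^sup>2))"
      unfolding J_def by (rule sum.Sigma) auto
    finally have "ennreal (real n / (32 * N\<^sup>2)) = (\<Sum>(k, j)\<in>J. ennreal (omega_w N k j / (32 * N\<^sup>2)))"
      using omega_w_pos[OF N] by (simp add: split_def sum_ennreal less_imp_le)
    also have "\<dots> \<le> (\<Sum>(k, j)\<in>J. ?T (Lint N k j))"
      unfolding J_def using backward_term_Lint[OF \<omega>] by (intro sum_mono) auto
    also have "\<dots> = (\<Sum>L\<in>F. ?T L)" unfolding F_def by (subst sum.reindex[OF inj]) (simp add: split_def)
    also have "\<dots> \<le> (\<Sum>r. ?T (I r))" by (rule sum_le_suminf_range[OF fin I(4)])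
    also have "\<dots> = (case ({0..1}, I) of (I0, I) \<Rightarrow> (\<Sum>r. backward_term (sigma_hat N) \<omega> I0 (I r)) / emeasure \<omega> I0)"
      using one by (simp add: divide_ennreal_def)
    also have "\<dots> \<le> ?S"
    proof (rule SUP_upper[where i="({0..1}, I)"])
      show "({0..1}, I) \<in> interval_decomps \<omega>"
        using I one is_interval_cc[of 0 "1::real"] by (simp add: interval_decomps_def)
    qed
    finally show ?thesis .
  qed
  show ?thesis
  proof (rule ccontr)
    assume "?S \<noteq> \<infinity>"
    then obtain r where r: "r \<ge> 0" "?S = ennreal r" by (cases ?S) auto
    obtain n where n: "r < real n * (1 / (32 * N\<^sup>2))"
      using reals_Archimedean3[of "1 / (32 * real N ^ 2)"] N by auto
    then show False using lower[of n] r by (simp add: ennreal_le_iff)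
  qed
qed

end

theorem theorem1:
  "\<exists>N0::nat. N0 \<ge> 16 \<and>
    (\<forall>N \<ge> N0. \<forall>\<rho>::real. 2/3 \<le> \<rho> \<and> \<rho> < 1 \<longrightarrow>
      (\<forall>b \<omega>. admissible_base N \<rho> b \<and> redistributed_cantor N \<omega> \<longrightarrow>
        (let K = kflat N b; \<sigma> = sigma_hat N in
          \<comment> \<open>(i)\<close>
          (\<forall>x. K (- x) = - K x) \<and>
          C_infty_on (- {0}) K \<and>
          std_CZ_kernel (\<lambda>x y. K (x - y)) \<and>
          (\<exists>c C. 0 < c \<and> c \<le> C \<and> (\<forall>x. x \<noteq> 0 \<longrightarrow> c / \<bar>x\<bar> \<le> \<bar>K x\<bar> \<and> \<bar>K x\<bar> \<le> C / \<bar>x\<bar>)) \<and>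
          \<comment> \<open>(ii)\<close>
          (\<exists>C::real. \<forall>g :: real \<Rightarrow> real.
             g \<in> borel_measurable \<omega> \<and> (\<integral>\<^sup>+ x. ennreal ((g x)^2) \<partial>\<omega>) < \<infinity> \<longrightarrow>
               (\<forall>y \<in> (\<Union>k. \<Union>j\<in>{..<2^k}. Lint N k j). integrable \<omega> (\<lambda>x. K (y - x) * g x)) \<and>
               (\<integral>\<^sup>+ y. ennreal ((\<integral> x. K (y - x) * g x \<partial>\<omega>)^2) \<partial>\<sigma>)
                  \<le> ennreal C * (\<integral>\<^sup>+ x. ennreal ((g x)^2) \<partial>\<omega>)) \<and>
          \<comment> \<open>(iii)\<close>
          (SUP (I0, I) \<in> interval_decomps \<omega>.
              (\<Sum>r. backward_term \<sigma> \<omega> I0 (I r)) / emeasure \<omega> I0) = \<infinity>)))"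
proof (intro exI[of _ 16] conjI allI impI)
  fix N :: nat and \<rho> :: real and b \<omega>
  assume N: "16 \<le> N" and "2 / 3 \<le> \<rho> \<and> \<rho> < 1" and "admissible_base N \<rho> b \<and> redistributed_cantor N \<omega>"
  then have \<rho>: "2/3 \<le> \<rho>" "\<rho> < 1" and adm: "admissible_base N \<rho> b" and \<omega>: "redistributed_cantor N \<omega>" by auto
  have elliptic: "\<exists>c C. 0 < c \<and> c \<le> C \<and> (\<forall>x. x \<noteq> 0 \<longrightarrow> c / \<bar>x\<bar> \<le> \<bar>kflat N b x\<bar> \<and> \<bar>kflat N b x\<bar> \<le> C / \<bar>x\<bar>)"
  proof (intro exI conjI allI impI)
    show "1 / real N \<le> real N" "0 < 1 / real N" using N by (auto intro: order_trans[of _ 1])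
  qed (use kflat_elliptic[OF N \<rho> adm] in auto)
  have bounded: "(\<forall>y \<in> (\<Union>k. \<Union>j\<in>{..<2^k}. Lint N k j). integrable \<omega> (\<lambda>x. kflat N b (y - x) * g x)) \<and>
      (\<integral>\<^sup>+ y. ennreal ((\<integral> x. kflat N b (y - x) * g x \<partial>\<omega>)^2) \<partial>sigma_hat N)
        \<le> ennreal 3 * (\<integral>\<^sup>+ x. ennreal ((g x)^2) \<partial>\<omega>)"
    if "g \<in> borel_measurable \<omega> \<and> (\<integral>\<^sup>+ x. ennreal ((g x)^2) \<partial>\<omega>) < \<infinity>" for g :: "real \<Rightarrow> real"
  proof -
    have g: "g \<in> borel_measurable borel" "(\<integral>\<^sup>+ x. ennreal ((g x)^2) \<partial>\<omega>) < \<infinity>"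
      using that measurable_cong_sets[OF sets_omega[OF N \<omega>] refl] by auto
    show ?thesis
      using kflat_integral(1)[OF N \<omega> \<rho> adm g] kflat_bounded[OF N \<omega> \<rho> adm g] by auto
  qed
  show "let K = kflat N b; \<sigma> = sigma_hat N in
          (\<forall>x. K (- x) = - K x) \<and>
          C_infty_on (- {0}) K \<and>
          std_CZ_kernel (\<lambda>x y. K (x - y)) \<and>
          (\<exists>c C. 0 < c \<and> c \<le> C \<and> (\<forall>x. x \<noteq> 0 \<longrightarrow> c / \<bar>x\<bar> \<le> \<bar>K x\<bar> \<and> \<bar>K x\<bar> \<le> C / \<bar>x\<bar>)) \<and>
          (\<exists>C::real. \<forall>g :: real \<Rightarrow> real.
             g \<in> borel_measurable \<omega> \<and> (\<integral>\<^sup>+ x. ennreal ((g x)^2) \<partial>\<omega>) < \<infinity> \<longrightarrow>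
               (\<forall>y \<in> (\<Union>k. \<Union>j\<in>{..<2^k}. Lint N k j). integrable \<omega> (\<lambda>x. K (y - x) * g x)) \<and>
               (\<integral>\<^sup>+ y. ennreal ((\<integral> x. K (y - x) * g x \<partial>\<omega>)^2) \<partial>\<sigma>)
                  \<le> ennreal C * (\<integral>\<^sup>+ x. ennreal ((g x)^2) \<partial>\<omega>)) \<and>
          (SUP (I0, I) \<in> interval_decomps \<omega>.
              (\<Sum>r. backward_term \<sigma> \<omega> I0 (I r)) / emeasure \<omega> I0) = \<infinity>"
    unfolding Let_def
  proof (intro conjI)
    show "\<forall>x. kflat N b (- x) = - kflat N b x" by (simp add: kflat_minus)
    show "C_infty_on (- {0}) (kflat N b)" by (rule C_infty_on_kflat[OF N \<rho> adm])
    show "std_CZ_kernel (\<lambda>x y. kflat N b (x - y))" by (rule kflat_std_CZ[OF N \<rho> adm])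
    show "(SUP (I0, I) \<in> interval_decomps \<omega>.
        (\<Sum>r. backward_term (sigma_hat N) \<omega> I0 (I r)) / emeasure \<omega> I0) = \<infinity>"
      by (rule backward_energy_unbounded[OF N \<omega>])
    show "\<exists>c C. 0 < c \<and> c \<le> C \<and> (\<forall>x. x \<noteq> 0 \<longrightarrow> c / \<bar>x\<bar> \<le> \<bar>kflat N b x\<bar> \<and> \<bar>kflat N b x\<bar> \<le> C / \<bar>x\<bar>)"
      by (rule elliptic)
    show "\<exists>C::real. \<forall>g :: real \<Rightarrow> real.
        g \<in> borel_measurable \<omega> \<and> (\<integral>\<^sup>+ x. ennreal ((g x)^2) \<partial>\<omega>) < \<infinity> \<longrightarrow>
          (\<forall>y \<in> (\<Union>k. \<Union>j\<in>{..<2^k}. Lint N k j). integrable \<omega> (\<lambda>x. kflat N b (y - x) * g x)) \<and>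
          (\<integral>\<^sup>+ y. ennreal ((\<integral> x. kflat N b (y - x) * g x \<partial>\<omega>)^2) \<partial>sigma_hat N)
            \<le> ennreal C * (\<integral>\<^sup>+ x. ennreal ((g x)^2) \<partial>\<omega>)"
      by (rule exI[of _ 3], rule allI, rule impI, rule bounded)
  qed
qed simp

end
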